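(* Let $H^2(\beta)$ be a weighted Hardy space of the unit disk $\mathbb{D}$ with $\beta(0)=1$ and generating function $k(z)=\sum_{j=0}^\infty z^j/\beta(j)^2$. Let $\varphi$ be a holomorphic function on $\mathbb{D}$ with $\varphi(\mathbb{D})\subseteq\mathbb{D}$, $\varphi(0)\neq 0$ and $\varphi'(0)\neq 0$. Let $\psi$ be an analytic function on $\mathbb{D}$ that is not the zero function. The following are equivalent. (i) $W_{\psi,\varphi}$ is a bounded Hermitian operator on $H^2(\beta)$. (ii) $W_{\psi,\varphi}$ is a bounded operator on $H^2(\beta)$ satisfying $$W_{\psi,\varphi}^*1=W_{\psi,\varphi}1,\quad W_{\psi,\varphi}^*z=W_{\psi,\varphi}z,\quad\text{and}\quad W_{\psi,\varphi}^*z^2=W_{\psi,\varphi}z^2.$$ (iii) The generating function $k$ takes one of the following forms: $$k(z)=e^{z/\beta(1)^2}\quad\text{in case}\quad \frac{2\beta(1)^4}{\beta(2)^2}=1,$$ and otherwise $$k(z)=(1-\lambda z)^{-\frac{1}{\lambda\beta(1)^2}},$$ where $\lambda=\frac{1}{\beta(1)^2}\left(\frac{2\beta(1)^4}{\beta(2)^2}-1\right)$ is a positive number less than or equal to $1$. In addition, the functions $\psi$ and $\varphi$ satisfy, for $z\in\mathbb{D}$, $$\psi(z)=c\,k(\overline{a_0}z)\quad\text{while}\quad \varphi(z)=a_0+a_1\beta(1)^2z\,\frac{k'(\overline{a_0}z)}{k(\overline{a_0}z)},$$ where $a_0=\varphi(0)$, $a_1=\varphi'(0)$ is real, and $c=\psi(0)$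 is real.
   Context: $\mathbb{D}$ is the open unit disk in $\mathbb{C}$. Let $\beta=(\beta(j))_{j\ge 0}$ be a sequence of positive numbers with $\beta(0)=1$ and $\liminf_{j\to\infty}\beta(j)^{1/j}\ge 1$. The weighted Hardy space $H^2(\beta)$ is the Hilbert space of functions $f(z)=\sum_j\hat f(j)z^j$ holomorphic on $\mathbb{D}$ with $\sum_{j}|\hat f(j)|^2\beta(j)^2<\infty$, with inner product $\langle f,g\rangle=\sum_j\hat f(j)\overline{\hat g(j)}\beta(j)^2$. Its generating function $k(z)=\sum_{j=0}^\infty z^j/\beta(j)^2$ is analytic on $\mathbb{D}$. For $\psi$ holomorphic on $\mathbb{D}$ and $\varphi$ a holomorphic selfmap of $\mathbb{D}$, the weighted composition operator is $W_{\psi,\varphi}f=\psi\cdot(f\circ\varphi)$; it is bounded on $H^2(\beta)$ if it maps $H^2(\beta)$ boundedly into itself, and then $W_{\psi,\varphi}^*$ is its Hilbert space adjoint on $H^2(\beta)$. "Hermitian" means $W_{\psi,\varphi}^*=W_{\psi,\varphi}$. The symbols $1,z,z^2$ in (ii) denote the monomial functions. Powers $(1-\lambda z)^{s}$ are principal branches. *)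

theory Defs
  imports "HOL-Complex_Analysis.Complex_Analysis"
begin

abbreviation unit_disk :: "complex set" where
  "unit_disk \<equiv> ball 0 1"

text \<open>Functions on the disk are represented by total functions that vanish off the disk, so that
  elements of the space are equal iff they agree on the disk.\<close>

definition on_disk :: "(complex \<Rightarrow> complex) \<Rightarrow> complex \<Rightarrow> complex" where
  "on_disk f = (\<lambda>z. if z \<in> unit_disk then f z else 0)"

definition weight_seq :: "(nat \<Rightarrow> real) \<Rightarrow> bool" where
  "weight_seq \<beta> \<longleftrightarrow>
     (\<forall>j. \<beta> j > 0) \<and> \<beta> 0 = 1 \<and> liminf (\<lambda>j. ereal (root j (\<beta> j))) \<ge> 1"

definition taylor_coeff :: "(complex \<Rightarrow> complex) \<Rightarrow> nat \<Rightarrow> complex" where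
  "taylor_coeff f j = (deriv ^^ j) f 0 / fact j"

definition weighted_hardy :: "(nat \<Rightarrow> real) \<Rightarrow> (complex \<Rightarrow> complex) set" where
  "weighted_hardy \<beta> = {f. f holomorphic_on unit_disk \<and> (\<forall>z. z \<notin> unit_disk \<longrightarrow> f z = 0) \<and>
     summable (\<lambda>j. (cmod (taylor_coeff f j))\<^sup>2 * (\<beta> j)\<^sup>2)}"

definition wh_inner :: "(nat \<Rightarrow> real) \<Rightarrow> (complex \<Rightarrow> complex) \<Rightarrow> (complex \<Rightarrow> complex) \<Rightarrow> complex" where
  "wh_inner \<beta> f g =
     (\<Sum>j. taylor_coeff f j * cnj (taylor_coeff g j) * complex_of_real ((\<beta> j)\<^sup>2))"

definition wh_norm :: "(nat \<Rightarrow> real) \<Rightarrow> (complex \<Rightarrow> complex) \<Rightarrow> real" where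
  "wh_norm \<beta> f = sqrt (Re (wh_inner \<beta> f f))"

definition generating_fun :: "(nat \<Rightarrow> real) \<Rightarrow> complex \<Rightarrow> complex" where
  "generating_fun \<beta> z = (\<Sum>j. z ^ j / complex_of_real ((\<beta> j)\<^sup>2))"

definition weighted_comp ::
    "(complex \<Rightarrow> complex) \<Rightarrow> (complex \<Rightarrow> complex) \<Rightarrow> (complex \<Rightarrow> complex) \<Rightarrow> complex \<Rightarrow> complex" where
  "weighted_comp \<psi> \<phi> f = on_disk (\<lambda>z. \<psi> z * f (\<phi> z))"

text \<open>Linearity is not part of the next predicate; it is used for weighted composition operators,
  which are linear.\<close>

definition wh_bounded ::
    "(nat \<Rightarrow> real) \<Rightarrow> ((complex \<Rightarrow> complex) \<Rightarrow> complex \<Rightarrow> complex) \<Rightarrow> bool" where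
  "wh_bounded \<beta> T \<longleftrightarrow>
     (\<forall>f\<in>weighted_hardy \<beta>. T f \<in> weighted_hardy \<beta>) \<and>
     (\<exists>C. \<forall>f\<in>weighted_hardy \<beta>. wh_norm \<beta> (T f) \<le> C * wh_norm \<beta> f)"

text \<open>The Hilbert space adjoint; the description is meaningful only for a bounded linear \<open>T\<close> and
  \<open>g\<close> in the space.\<close>

definition wh_adjoint ::
    "(nat \<Rightarrow> real) \<Rightarrow> ((complex \<Rightarrow> complex) \<Rightarrow> complex \<Rightarrow> complex) \<Rightarrow>
     (complex \<Rightarrow> complex) \<Rightarrow> complex \<Rightarrow> complex" where
  "wh_adjoint \<beta> T g = (THE h. h \<in> weighted_hardy \<beta> \<and>
     (\<forall>f\<in>weighted_hardy \<beta>. wh_inner \<beta> (T f) g = wh_inner \<beta> f h))"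

definition wh_hermitian ::
    "(nat \<Rightarrow> real) \<Rightarrow> ((complex \<Rightarrow> complex) \<Rightarrow> complex \<Rightarrow> complex) \<Rightarrow> bool" where
  "wh_hermitian \<beta> T \<longleftrightarrow> (\<forall>f\<in>weighted_hardy \<beta>. wh_adjoint \<beta> T f = T f)"

end

theory Submission
  imports Defs
begin

text \<open>The reproducing kernel at \<open>w\<close> is \<open>z \<mapsto> k (cnj w * z)\<close>, and the adjoint of a bounded weighted
  composition operator sends it to \<open>cnj (\<psi> w)\<close> times the kernel at \<open>\<phi> w\<close>. So the operator is
  Hermitian exactly if \<open>\<psi> z * k (cnj w * \<phi> z) = cnj (\<psi> w) * k (cnj (\<phi> w) * z)\<close> for all \<open>z\<close>
  and \<open>w\<close>, and both nontrivial implications are about this identity.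

  Equality of the operator and its adjoint on \<open>1, z, z\<^sup>2\<close> gives the Taylor coefficients of the identity
  of order 0, 1 and 2 in \<open>z\<close> (\<open>adjoint_on_monomial\<close>). The first says that \<open>\<psi>\<close> is a real multiple of a
  kernel. The second expresses \<open>\<phi>\<close> by the logarithmic derivative of \<open>k\<close>. With these, the
  third becomes the differential equation \<open>k * k'' = \<mu> * (k')\<^sup>2\<close> (\<open>quadratic_ODE_at\<close>). It
  says that \<open>k / k'\<close> has constant derivative, whence \<open>k' * (1 - l * z) = k' 0 * k\<close>
  (\<open>quadratic_ODE_linearize\<close>), whose solutions are the two families in the theorem. Positivity of the
  coefficients of \<open>k\<close> and convergence on the disk confine \<open>l\<close> to the interval from 0 to 1
  (\<open>linear_ODE_parameter_bounds\<close>).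

  Conversely, for these \<open>k\<close>, \<open>\<psi>\<close>, \<open>\<phi>\<close> the identity is a computation with powers. The substance is
  boundedness. By the identity, the operator is symmetric on the span of the kernels and
  maps this span to itself. A symmetric operator \<open>T\<close> satisfies
  \<open>\<parallel>T ^ N u\<parallel>\<^sup>2 \<le> \<parallel>u\<parallel> * \<parallel>T ^ (2 * N) u\<parallel>\<close>, so iterated doubling shows that \<open>\<parallel>T u\<parallel> \<le> D * \<parallel>u\<parallel>\<close>
  as soon as \<open>\<parallel>T ^ N u\<parallel> \<le> A * D ^ N\<close>, where \<open>A\<close> may depend on \<open>u\<close> but \<open>D\<close> does not
  (\<open>first_step_bounded_by_growth_rate\<close>). The powers are again weighted composition operators, with
  the iterates of \<open>\<phi>\<close>; by the Schwarz-Pick lemma these approach the circle at most exponentially fast,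
  and \<open>k\<close> has polynomial growth there (\<open>kernel_span_bound\<close>). The span of the kernels is dense, and
  duality extends the bound to the whole space (\<open>coord_bounded_by_point_evaluations\<close>,
  \<open>wh_bounded_if_symmetric\<close>). Finally the adjoint, which exists by the Riesz representation
  theorem, is computed by testing on kernels (\<open>wh_hermitian_if_symmetric\<close>).\<close>

section \<open>Square-summable sequences\<close>

definition square_summable :: "(nat \<Rightarrow> complex) \<Rightarrow> bool" where
  "square_summable x \<longleftrightarrow> summable (\<lambda>n. (cmod (x n))\<^sup>2)"

definition l2_inner :: "(nat \<Rightarrow> complex) \<Rightarrow> (nat \<Rightarrow> complex) \<Rightarrow> complex" where
  "l2_inner x y = (\<Sum>n. x n * cnj (y n))"

definition l2_normsq :: "(nat \<Rightarrow> complex) \<Rightarrow> real" where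
  "l2_normsq x = (\<Sum>n. (cmod (x n))\<^sup>2)"

lemma l2_normsq_nonneg: "square_summable x \<Longrightarrow> 0 \<le> l2_normsq x"
  unfolding l2_normsq_def square_summable_def by (rule suminf_nonneg) auto

lemma summable_norm_l2_inner:
  assumes "square_summable x" "square_summable y"
  shows "summable (\<lambda>n. cmod (x n * cnj (y n)))"
proof (rule summable_comparison_test')
  show "summable (\<lambda>n. (cmod (x n))\<^sup>2 + (cmod (y n))\<^sup>2)"
    using assms unfolding square_summable_def by (rule summable_add)
  fix n :: nat
  have "0 \<le> (cmod (x n) - cmod (y n))\<^sup>2" "0 \<le> (cmod (x n))\<^sup>2" "0 \<le> (cmod (y n))\<^sup>2"
    "0 \<le> cmod (x n) * cmod (y n)"
    by simp_all
  then show "norm (cmod (x n * cnj (y n))) \<le> (cmod (x n))\<^sup>2 + (cmod (y n))\<^sup>2"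
    unfolding power2_diff norm_mult complex_mod_cnj real_norm_def abs_mult abs_norm_cancel
    by linarith
qed

lemmas summable_l2_inner = summable_norm_cancel[OF summable_norm_l2_inner]

lemma l2_Cauchy_Schwarz:
  assumes "square_summable x" "square_summable y"
  shows "(cmod (l2_inner x y))\<^sup>2 \<le> l2_normsq x * l2_normsq y"
proof -
  let ?a = "\<lambda>n. cmod (x n * cnj (y n))"
  have "(\<lambda>N. (\<Sum>n<N. ?a n)\<^sup>2) \<longlonglongrightarrow> (\<Sum>n. ?a n)\<^sup>2"
    by (intro tendsto_intros summable_LIMSEQ summable_norm_l2_inner assms)
  moreover have "(\<Sum>n<N. ?a n)\<^sup>2 \<le> l2_normsq x * l2_normsq y" for N
  proof -
    have "(\<Sum>n<N. ?a n)\<^sup>2 \<le> (\<Sum>n<N. (cmod (x n))\<^sup>2) * (\<Sum>n<N. (cmod (y n))\<^sup>2)"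
      using Cauchy_Schwarz_ineq_sum[of "\<lambda>n. cmod (x n)" "\<lambda>n. cmod (y n)" "{..<N}"]
      by (simp add: norm_mult)
    also have "\<dots> \<le> l2_normsq x * l2_normsq y"
      using assms unfolding l2_normsq_def square_summable_def
      by (intro mult_mono sum_le_suminf suminf_nonneg sum_nonneg) auto
    finally show ?thesis .
  qed
  ultimately have "(\<Sum>n. ?a n)\<^sup>2 \<le> l2_normsq x * l2_normsq y"
    by (blast intro: LIMSEQ_le_const2)
  moreover have "(cmod (l2_inner x y))\<^sup>2 \<le> (\<Sum>n. ?a n)\<^sup>2"
    unfolding l2_inner_def
    by (intro power_mono summable_norm summable_norm_l2_inner assms) auto
  ultimately show ?thesis by linarith
qed

lemma l2_inner_self:
  assumes "square_summable x"
  shows "l2_inner x x = complex_of_real (l2_normsq x)"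
proof -
  have "x n * cnj (x n) = complex_of_real ((cmod (x n))\<^sup>2)" for n
    by (simp only: complex_norm_square)
  then show ?thesis
    using assms unfolding l2_inner_def l2_normsq_def square_summable_def
    by (simp add: suminf_of_real del: of_real_power)
qed

lemma l2_inner_commute:
  assumes "square_summable x" "square_summable y"
  shows "l2_inner y x = cnj (l2_inner x y)"
  unfolding l2_inner_def
  using bounded_linear.suminf[OF bounded_linear_cnj summable_l2_inner[OF assms]]
  by (simp add: mult.commute)

lemma square_summable_scale:
  assumes "square_summable x" shows "square_summable (\<lambda>n. c * x n)"
  using assms unfolding square_summable_def
  by (simp add: norm_mult power_mult_distrib summable_mult)

lemma square_summable_add:
  assumes "square_summable x" "square_summable y"
  shows "square_summable (\<lambda>n. x n + y n)"
  unfolding square_summable_def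
proof (rule summable_comparison_test')
  show "summable (\<lambda>n. 2 * (cmod (x n))\<^sup>2 + 2 * (cmod (y n))\<^sup>2)"
    using assms unfolding square_summable_def by (intro summable_add summable_mult)
  fix n :: nat
  have "(cmod (x n + y n))\<^sup>2 \<le> (cmod (x n) + cmod (y n))\<^sup>2"
    by (intro power_mono norm_triangle_ineq) auto
  moreover have "0 \<le> (cmod (x n) - cmod (y n))\<^sup>2" by simp
  ultimately show "norm ((cmod (x n + y n))\<^sup>2) \<le> 2 * (cmod (x n))\<^sup>2 + 2 * (cmod (y n))\<^sup>2"
    unfolding power2_diff power2_sum by simp
qed

lemma square_summable_sum:
  assumes "finite I" "\<And>i. i \<in> I \<Longrightarrow> square_summable (v i)"
  shows "square_summable (\<lambda>n. \<Sum>i\<in>I. c i * v i n)"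
  using assms
proof (induction I rule: finite_induct)
  case empty
  then show ?case by (simp add: square_summable_def)
next
  case (insert i I)
  then show ?case
    by (auto intro!: square_summable_add square_summable_scale)
qed

lemma l2_inner_sum_left:
  assumes "finite I" "\<And>i. i \<in> I \<Longrightarrow> square_summable (v i)" "square_summable y"
  shows "l2_inner (\<lambda>n. \<Sum>i\<in>I. c i * v i n) y = (\<Sum>i\<in>I. c i * l2_inner (v i) y)"
proof -
  have s: "summable (\<lambda>n. v i n * cnj (y n))" if "i \<in> I" for i
    using assms that by (intro summable_l2_inner) auto
  have "l2_inner (\<lambda>n. \<Sum>i\<in>I. c i * v i n) y = (\<Sum>n. \<Sum>i\<in>I. c i * (v i n * cnj (y n)))"
    by (simp add: l2_inner_def sum_distrib_right mult.assoc)
  also have "\<dots> = (\<Sum>i\<in>I. \<Sum>n. c i * (v i n * cnj (y n)))"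
    by (rule suminf_sum) (intro summable_mult s)
  also have "\<dots> = (\<Sum>i\<in>I. c i * l2_inner (v i) y)"
    unfolding l2_inner_def using suminf_mult[OF s] by simp
  finally show ?thesis .
qed

lemma l2_inner_sum_right:
  assumes "finite I" "\<And>i. i \<in> I \<Longrightarrow> square_summable (v i)" "square_summable x"
  shows "l2_inner x (\<lambda>n. \<Sum>i\<in>I. c i * v i n) = (\<Sum>i\<in>I. cnj (c i) * l2_inner x (v i))"
proof -
  have "l2_inner x (\<lambda>n. \<Sum>i\<in>I. c i * v i n) = cnj (l2_inner (\<lambda>n. \<Sum>i\<in>I. c i * v i n) x)"
    using assms by (intro l2_inner_commute square_summable_sum) auto
  also have "\<dots> = (\<Sum>i\<in>I. cnj (c i) * cnj (l2_inner (v i) x))"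
    using assms by (simp add: l2_inner_sum_left)
  also have "\<dots> = (\<Sum>i\<in>I. cnj (c i) * l2_inner x (v i))"
    using assms by (intro sum.cong) (simp_all add: l2_inner_commute[of _ x])
  finally show ?thesis .
qed

section \<open>Taylor coefficients of functions on the disk\<close>

lemma taylor_coeff_sums:
  assumes "f holomorphic_on unit_disk" "z \<in> unit_disk"
  shows "(\<lambda>n. taylor_coeff f n * z ^ n) sums f z"
  using holomorphic_power_series[of f 0 1 z] assms by (simp add: taylor_coeff_def)

text \<open>Uniqueness of power series is used throughout to compute coefficients.\<close>

lemma taylor_coeff_eqI:
  assumes "\<And>z. z \<in> unit_disk \<Longrightarrow> (\<lambda>n. a n * z ^ n) sums f z"
  shows "taylor_coeff f n = a n"
proof -
  have "eventually (\<lambda>z. z \<in> unit_disk) (nhds (0 :: complex))"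
    by (intro eventually_nhds_in_open) auto
  then have "eventually (\<lambda>z. (\<lambda>n. fps_nth (Abs_fps a) n * z ^ n) sums f z) (nhds 0)"
    by eventually_elim (use assms in simp)
  then have "f has_fps_expansion Abs_fps a"
    by (rule has_fps_expansionI)
  from fps_nth_fps_expansion[OF this, of n] show ?thesis
    by (simp add: taylor_coeff_def)
qed

lemma taylor_coeff_cong:
  assumes "f holomorphic_on unit_disk" "\<And>z. z \<in> unit_disk \<Longrightarrow> g z = f z"
  shows "taylor_coeff g n = taylor_coeff f n"
  by (rule taylor_coeff_eqI) (use assms taylor_coeff_sums in simp)

lemma holomorphic_on_disk:
  assumes "f holomorphic_on unit_disk" shows "on_disk f holomorphic_on unit_disk"
  by (rule holomorphic_transform[OF assms]) (simp add: on_disk_def)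

lemma on_disk_apply: "z \<in> unit_disk \<Longrightarrow> on_disk f z = f z"
  by (simp add: on_disk_def)

lemma taylor_coeff_on_disk:
  "f holomorphic_on unit_disk \<Longrightarrow> taylor_coeff (on_disk f) n = taylor_coeff f n"
  by (rule taylor_coeff_cong) (simp_all add: on_disk_apply)

lemma taylor_coeff_simps:
  assumes "f holomorphic_on unit_disk"
  shows "taylor_coeff f 0 = f 0" "taylor_coeff f 1 = deriv f 0"
    "taylor_coeff f 2 = deriv (deriv f) 0 / 2"
  by (simp_all add: taylor_coeff_def numeral_2_eq_2)

lemma mult_unit_disk:
  assumes "z \<in> unit_disk" "w \<in> unit_disk" shows "cnj w * z \<in> unit_disk"
  using assms mult_strict_mono'[of "cmod w" 1 "cmod z" 1] by (simp add: norm_mult)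

lemma dilate_holomorphic:
  assumes "f holomorphic_on unit_disk" "a \<in> unit_disk"
  shows "(\<lambda>z. f (cnj a * z)) holomorphic_on unit_disk"
proof -
  have "(f \<circ> (\<lambda>z. cnj a * z)) holomorphic_on unit_disk"
    by (rule holomorphic_on_compose_gen[OF _ assms(1)])
       (auto intro!: holomorphic_intros simp: mult_unit_disk[OF _ assms(2), simplified])
  then show ?thesis by (simp add: o_def)
qed

lemma taylor_coeff_dilation:
  assumes "f holomorphic_on unit_disk" "a \<in> unit_disk"
  shows "taylor_coeff (\<lambda>z. f (cnj a * z)) n = cnj a ^ n * taylor_coeff f n"
proof (rule taylor_coeff_eqI)
  fix z :: complex assume "z \<in> unit_disk"
  then show "(\<lambda>n. cnj a ^ n * taylor_coeff f n * z ^ n) sums f (cnj a * z)"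
    using taylor_coeff_sums[OF assms(1) mult_unit_disk[OF _ assms(2)]]
    by (simp add: power_mult_distrib mult_ac)
qed

lemma deriv_dilation:
  assumes "f holomorphic_on unit_disk" "a \<in> unit_disk" "z \<in> unit_disk"
  shows "deriv (\<lambda>z. f (cnj a * z)) z = cnj a * deriv f (cnj a * z)"
    and "deriv (deriv (\<lambda>z. f (cnj a * z))) z = (cnj a)\<^sup>2 * deriv (deriv f) (cnj a * z)"
proof -
  have d: "(deriv ^^ n) (\<lambda>z. f (cnj a * z)) z = cnj a ^ n * (deriv ^^ n) f (cnj a * z)" for n
    by (rule higher_deriv_compose_linear[OF assms(1) open_ball open_ball assms(3)])
       (rule mult_unit_disk[OF _ assms(2)])
  show "deriv (\<lambda>z. f (cnj a * z)) z = cnj a * deriv f (cnj a * z)"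
    using d[of 1] by simp
  show "deriv (deriv (\<lambda>z. f (cnj a * z))) z = (cnj a)\<^sup>2 * deriv (deriv f) (cnj a * z)"
    using d[of 2] by (simp add: numeral_2_eq_2)
qed

lemma taylor_coeff_deriv: "taylor_coeff (deriv f) n = of_nat (Suc n) * taylor_coeff f (Suc n)"
  unfolding taylor_coeff_def
  by (simp del: funpow.simps of_nat_Suc add: funpow_Suc_right)

lemma taylor_coeff_times_z:
  assumes "f holomorphic_on unit_disk"
  shows "taylor_coeff (\<lambda>z. z * f z) (Suc n) = taylor_coeff f n"
proof -
  have "taylor_coeff (\<lambda>z. z * f z) (Suc n)
      = (case Suc n of 0 \<Rightarrow> 0 | Suc m \<Rightarrow> taylor_coeff f m)"
  proof (rule taylor_coeff_eqI)
    fix z :: complex assume z: "z \<in> unit_disk"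
    have "(\<lambda>m. z * (taylor_coeff f m * z ^ m)) sums (z * f z)"
      by (intro sums_mult taylor_coeff_sums assms z)
    then have "(\<lambda>m. (case Suc m of 0 \<Rightarrow> 0 | Suc m \<Rightarrow> taylor_coeff f m) * z ^ Suc m) sums (z * f z)"
      by (simp add: mult_ac)
    then show "(\<lambda>m. (case m of 0 \<Rightarrow> 0 | Suc m \<Rightarrow> taylor_coeff f m) * z ^ m) sums (z * f z)"
      by (subst (asm) sums_Suc_iff) simp
  qed
  then show ?thesis by simp
qed

lemma taylor_coeff_mult:
  assumes "f holomorphic_on unit_disk" "g holomorphic_on unit_disk"
  shows "taylor_coeff (\<lambda>z. f z * g z) n
       = (\<Sum>i\<le>n. taylor_coeff f i * taylor_coeff g (n - i))"
proof -
  have eq: "(deriv ^^ n) (\<lambda>z. f z * g z) 0 = (\<Sum>i\<le>n. of_nat (n choose i) * (deriv ^^ i) f 0 * (deriv ^^ (n - i)) g 0)"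
    using higher_deriv_mult[OF assms open_ball, of 0 n] by (simp add: atLeast0AtMost)
  show ?thesis
    unfolding taylor_coeff_def eq sum_divide_distrib
    by (intro sum.cong refl) (simp add: binomial_fact)
qed

lemma taylor_coeff_compose:
  assumes g: "g holomorphic_on unit_disk" and \<phi>: "\<phi> holomorphic_on unit_disk"
    and self: "\<phi> ` unit_disk \<subseteq> unit_disk"
  shows "taylor_coeff (\<lambda>z. g (\<phi> z)) 0 = g (\<phi> 0)"
    and "taylor_coeff (\<lambda>z. g (\<phi> z)) 1 = deriv g (\<phi> 0) * deriv \<phi> 0"
    and "taylor_coeff (\<lambda>z. g (\<phi> z)) 2
      = deriv (deriv g) (\<phi> 0) * (deriv \<phi> 0)\<^sup>2 / 2 + deriv g (\<phi> 0) * taylor_coeff \<phi> 2"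
proof -
  have self': "\<phi> z \<in> unit_disk" if "z \<in> unit_disk" for z
    using self that by blast
  have g': "deriv g holomorphic_on unit_disk" and \<phi>': "deriv \<phi> holomorphic_on unit_disk"
    using g \<phi> by (auto intro!: holomorphic_deriv)
  have comp: "(\<lambda>z. f (\<phi> z)) holomorphic_on unit_disk" if "f holomorphic_on unit_disk" for f
    using holomorphic_on_compose_gen[OF \<phi> that self] by (simp add: o_def)
  have chain: "((\<lambda>z. f (\<phi> z)) has_field_derivative deriv f (\<phi> z) * deriv \<phi> z) (at z)"
    if "f holomorphic_on unit_disk" "z \<in> unit_disk" for f z
    by (rule DERIV_chain2)
       (auto intro!: holomorphic_derivI[OF that(1)] holomorphic_derivI[OF \<phi>] that self')
  have d1: "deriv (\<lambda>z. g (\<phi> z)) z = deriv g (\<phi> z) * deriv \<phi> z" if "z \<in> unit_disk" for z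
    using chain[OF g that] by (rule DERIV_imp_deriv)
  have "deriv (deriv (\<lambda>z. g (\<phi> z))) 0 = deriv (\<lambda>z. deriv g (\<phi> z) * deriv \<phi> z) 0"
    by (rule complex_derivative_transform_within_open[OF _ _ open_ball])
       (auto intro!: d1 holomorphic_intros holomorphic_deriv comp g g' \<phi>')
  also have "\<dots> = deriv (deriv g) (\<phi> 0) * deriv \<phi> 0 * deriv \<phi> 0 + deriv (deriv \<phi>) 0 * deriv g (\<phi> 0)"
    by (rule DERIV_imp_deriv, rule DERIV_mult)
       (auto intro!: chain g' holomorphic_derivI[OF \<phi>'])
  finally have d2: "deriv (deriv (\<lambda>z. g (\<phi> z))) 0
      = deriv (deriv g) (\<phi> 0) * (deriv \<phi> 0)\<^sup>2 + deriv (deriv \<phi>) 0 * deriv g (\<phi> 0)"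
    by (simp add: power2_eq_square)
  note simps = taylor_coeff_simps[OF comp[OF g]] taylor_coeff_simps[OF \<phi>]
  show "taylor_coeff (\<lambda>z. g (\<phi> z)) 0 = g (\<phi> 0)"
    "taylor_coeff (\<lambda>z. g (\<phi> z)) 1 = deriv g (\<phi> 0) * deriv \<phi> 0"
    "taylor_coeff (\<lambda>z. g (\<phi> z)) 2
      = deriv (deriv g) (\<phi> 0) * (deriv \<phi> 0)\<^sup>2 / 2 + deriv g (\<phi> 0) * taylor_coeff \<phi> 2"
    unfolding simps by (simp_all add: d1 d2 add_divide_distrib mult_ac)
qed

lemma cnj_of_real_taylor_coeffs:
  assumes "f holomorphic_on unit_disk" "\<And>n. taylor_coeff f n \<in> \<real>" "z \<in> unit_disk"
  shows "cnj (f z) = f (cnj z)"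
proof -
  have "(\<lambda>n. cnj (taylor_coeff f n * z ^ n)) sums cnj (f z)"
    using bounded_linear.sums[OF bounded_linear_cnj taylor_coeff_sums[OF assms(1,3)]] .
  then have "(\<lambda>n. taylor_coeff f n * cnj z ^ n) sums cnj (f z)"
    using assms(2) by (simp add: Reals_cnj_iff)
  moreover have "(\<lambda>n. taylor_coeff f n * cnj z ^ n) sums f (cnj z)"
    using assms by (intro taylor_coeff_sums) auto
  ultimately show ?thesis by (rule sums_unique2)
qed

section \<open>The space as a sequence space, and its kernels\<close>

locale weighted_hardy_space =
  fixes \<beta> :: "nat \<Rightarrow> real"
  assumes weight_seq: "weight_seq \<beta>"
begin

lemma beta_pos: "0 < \<beta> n"
  and beta_0: "\<beta> 0 = 1"
  using weight_seq by (auto simp: weight_seq_def)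

lemma beta_nonzero [simp]: "\<beta> n \<noteq> 0"
  using beta_pos[of n] by simp

lemma summable_kernel_series:
  assumes "0 \<le> r" "r < 1"
  shows "summable (\<lambda>n. r ^ n / (\<beta> n)\<^sup>2)"
proof -
  \<comment> \<open>Any \<open>\<rho>\<close> with \<open>r < \<rho>\<^sup>2\<close> and \<open>\<rho> < 1\<close> would do: eventually \<open>\<beta> j \<ge> \<rho> ^ j\<close>, so the
    series is dominated by a geometric one with ratio \<open>r / \<rho>\<^sup>2\<close>.\<close>
  define \<rho> where "\<rho> = sqrt ((1 + r) / 2)"
  have \<rho>: "0 < \<rho>" "\<rho> < 1" "r < \<rho>\<^sup>2"
    using assms by (auto simp: \<rho>_def real_sqrt_lt_1_iff)
  have "ereal \<rho> < liminf (\<lambda>j. ereal (root j (\<beta> j)))"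
    using weight_seq \<rho> unfolding weight_seq_def
    by (metis ereal_less_eq(3) linorder_not_le one_ereal_def order_trans)
  then have "eventually (\<lambda>j. ereal \<rho> < ereal (root j (\<beta> j))) sequentially"
    by (rule less_LiminfD)
  then have "eventually (\<lambda>j. norm (r ^ j / (\<beta> j)\<^sup>2) \<le> (r / \<rho>\<^sup>2) ^ j) sequentially"
    using eventually_gt_at_top[of 0]
  proof eventually_elim
    case (elim j)
    then have "\<rho> ^ j \<le> root j (\<beta> j) ^ j"
      using \<rho> by (intro power_mono) auto
    also have "\<dots> = \<beta> j"
      using elim beta_pos[of j] by (intro real_root_pow_pos2) auto
    finally have "(\<rho> ^ j)\<^sup>2 \<le> (\<beta> j)\<^sup>2"
      using \<rho> by (intro power_mono) auto
    moreover have "0 < (\<rho> ^ j)\<^sup>2" using \<rho> by simp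
    ultimately have "r ^ j / (\<beta> j)\<^sup>2 \<le> r ^ j / (\<rho> ^ j)\<^sup>2"
      using assms by (intro divide_left_mono) (auto simp: beta_pos)
    then show ?case
      using assms by (simp add: power_divide mult.commute flip: power_mult)
  qed
  moreover have "summable (\<lambda>j. (r / \<rho>\<^sup>2) ^ j)"
    using \<rho> assms by (intro summable_geometric) (simp add: divide_simps)
  ultimately show ?thesis
    by (rule summable_comparison_test_ev)
qed

text \<open>Multiplication of the Taylor coefficients by the weights identifies the space isometrically
  with the square-summable sequences.\<close>

definition coord :: "(complex \<Rightarrow> complex) \<Rightarrow> nat \<Rightarrow> complex" where
  "coord f n = taylor_coeff f n * complex_of_real (\<beta> n)"

text \<open>The coordinate sequence of the reproducing kernel at \<open>w\<close>.\<close>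

definition kernel_coord :: "complex \<Rightarrow> nat \<Rightarrow> complex" where
  "kernel_coord w n = cnj w ^ n / complex_of_real (\<beta> n)"

lemma weighted_hardy_iff:
  "f \<in> weighted_hardy \<beta> \<longleftrightarrow>
     f holomorphic_on unit_disk \<and> (\<forall>z. z \<notin> unit_disk \<longrightarrow> f z = 0) \<and> square_summable (coord f)"
  by (simp add: weighted_hardy_def square_summable_def coord_def norm_mult power_mult_distrib)

lemma wh_inner_eq: "wh_inner \<beta> f g = l2_inner (coord f) (coord g)"
  by (simp add: wh_inner_def l2_inner_def coord_def power2_eq_square mult_ac)

lemma wh_norm_eq: "f \<in> weighted_hardy \<beta> \<Longrightarrow> wh_norm \<beta> f = sqrt (l2_normsq (coord f))"
  by (simp add: wh_norm_def wh_inner_eq l2_inner_self weighted_hardy_iff)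

lemma square_summable_kernel_coord:
  assumes "w \<in> unit_disk" shows "square_summable (kernel_coord w)"
proof -
  have "(cmod w)\<^sup>2 < 1"
    using assms by (simp add: power_less_one_iff abs_square_less_1)
  from summable_kernel_series[OF _ this] show ?thesis
    by (simp add: square_summable_def kernel_coord_def norm_divide norm_power power_divide
          flip: power_mult)  (simp add: mult.commute)
qed

lemma l2_inner_kernel_coord:
  assumes "f holomorphic_on unit_disk" "w \<in> unit_disk"
  shows "l2_inner (coord f) (kernel_coord w) = f w"
proof -
  have "l2_inner (coord f) (kernel_coord w) = (\<Sum>n. taylor_coeff f n * w ^ n)"
    unfolding l2_inner_def coord_def kernel_coord_def by (intro suminf_cong) simp
  also have "\<dots> = f w"
    using taylor_coeff_sums[OF assms] by (simp add: sums_iff)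
  finally show ?thesis .
qed

lemma summable_square_summable_coeffs:
  assumes "square_summable (\<lambda>n. a n * complex_of_real (\<beta> n))" "z \<in> unit_disk"
  shows "summable (\<lambda>n. a n * z ^ n)"
proof -
  have "summable (\<lambda>n. a n * complex_of_real (\<beta> n) * cnj (kernel_coord z n))"
    using assms by (intro summable_l2_inner square_summable_kernel_coord)
  then show ?thesis by (simp add: kernel_coord_def)
qed

text \<open>Square-summability of the weighted coefficients already forces convergence on the disk, by
  pairing them with the kernel at the given point.\<close>

lemma power_series_in_hardy:
  assumes "square_summable (\<lambda>n. a n * complex_of_real (\<beta> n))"
  defines "f \<equiv> on_disk (\<lambda>z. \<Sum>n. a n * z ^ n)"
  shows "f \<in> weighted_hardy \<beta>" "taylor_coeff f n = a n"
proof -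
  have sums: "(\<lambda>n. a n * z ^ n) sums f z" if "z \<in> unit_disk" for z
    using summable_square_summable_coeffs[OF assms(1) that] that
    by (simp add: f_def on_disk_apply summable_sums)
  then have tc: "taylor_coeff f n = a n" for n
    by (rule taylor_coeff_eqI)
  then show "taylor_coeff f n = a n" .
  have "f holomorphic_on unit_disk"
    by (rule power_series_holomorphic[of 0 1 a]) (use sums in simp)
  moreover have "coord f = (\<lambda>n. a n * complex_of_real (\<beta> n))"
    by (auto simp: coord_def tc)
  ultimately show "f \<in> weighted_hardy \<beta>"
    using assms by (auto simp: weighted_hardy_iff f_def on_disk_def)
qed

lemma hardy_eqI:
  assumes "f \<in> weighted_hardy \<beta>" "g \<in> weighted_hardy \<beta>" "\<And>z. z \<in> unit_disk \<Longrightarrow> f z = g z"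
  shows "f = g"
  using assms by (auto simp: weighted_hardy_def fun_eq_iff) (metis (no_types, lifting))

lemma hardy_add:
  assumes "f \<in> weighted_hardy \<beta>" "g \<in> weighted_hardy \<beta>"
  shows "(\<lambda>z. f z + g z) \<in> weighted_hardy \<beta>"
    and "coord (\<lambda>z. f z + g z) = (\<lambda>n. coord f n + coord g n)"
proof -
  have hol: "f holomorphic_on unit_disk" "g holomorphic_on unit_disk"
    using assms by (auto simp: weighted_hardy_iff)
  have "taylor_coeff (\<lambda>z. f z + g z) n = taylor_coeff f n + taylor_coeff g n" for n
    by (rule taylor_coeff_eqI) (simp add: ring_distribs sums_add taylor_coeff_sums hol)
  then show c: "coord (\<lambda>z. f z + g z) = (\<lambda>n. coord f n + coord g n)"
    by (simp add: coord_def ring_distribs fun_eq_iff)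
  show "(\<lambda>z. f z + g z) \<in> weighted_hardy \<beta>"
    using assms hol by (auto simp: weighted_hardy_iff c intro!: holomorphic_intros square_summable_add)
qed

lemma hardy_scale:
  assumes "f \<in> weighted_hardy \<beta>"
  shows "(\<lambda>z. a * f z) \<in> weighted_hardy \<beta>"
    and "coord (\<lambda>z. a * f z) = (\<lambda>n. a * coord f n)"
proof -
  have hol: "f holomorphic_on unit_disk"
    using assms by (auto simp: weighted_hardy_iff)
  have "taylor_coeff (\<lambda>z. a * f z) n = a * taylor_coeff f n" for n
    by (rule taylor_coeff_eqI) (simp add: mult.assoc sums_mult taylor_coeff_sums hol)
  then show c: "coord (\<lambda>z. a * f z) = (\<lambda>n. a * coord f n)"
    by (simp add: coord_def mult.assoc fun_eq_iff)
  show "(\<lambda>z. a * f z) \<in> weighted_hardy \<beta>"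
    using assms hol by (auto simp: weighted_hardy_iff c intro!: holomorphic_intros square_summable_scale)
qed

lemma wh_inner_commute:
  assumes "f \<in> weighted_hardy \<beta>" "g \<in> weighted_hardy \<beta>"
  shows "wh_inner \<beta> g f = cnj (wh_inner \<beta> f g)"
  using assms by (simp add: wh_inner_eq weighted_hardy_iff l2_inner_commute[of "coord f"])

lemma wh_inner_scale_left:
  assumes "f \<in> weighted_hardy \<beta>" "g \<in> weighted_hardy \<beta>"
  shows "wh_inner \<beta> (\<lambda>z. a * f z) g = a * wh_inner \<beta> f g"
  using assms unfolding wh_inner_eq hardy_scale(2)[OF assms(1)] l2_inner_def
  by (subst suminf_mult[symmetric]) (auto intro!: summable_l2_inner simp: weighted_hardy_iff mult.assoc)

lemma wh_Cauchy_Schwarz: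
  assumes "f \<in> weighted_hardy \<beta>" "g \<in> weighted_hardy \<beta>"
  shows "cmod (wh_inner \<beta> f g) \<le> wh_norm \<beta> f * wh_norm \<beta> g"
  using l2_Cauchy_Schwarz[of "coord f" "coord g"] assms
  by (simp add: wh_inner_eq wh_norm_eq weighted_hardy_iff real_le_rsqrt flip: real_sqrt_mult)

definition kernel_fun :: "complex \<Rightarrow> complex \<Rightarrow> complex" where
  "kernel_fun w = on_disk (\<lambda>z. generating_fun \<beta> (cnj w * z))"

lemma generating_fun_sums:
  assumes "z \<in> unit_disk"
  shows "(\<lambda>n. complex_of_real (1 / (\<beta> n)\<^sup>2) * z ^ n) sums generating_fun \<beta> z"
proof -
  have "summable (\<lambda>n. norm (complex_of_real (1 / (\<beta> n)\<^sup>2) * z ^ n))"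
    using summable_kernel_series[of "cmod z"] assms by (simp add: norm_mult norm_divide norm_power)
  from summable_sums[OF summable_norm_cancel[OF this]] show ?thesis
    by (simp add: generating_fun_def)
qed

lemma generating_fun_holomorphic: "generating_fun \<beta> holomorphic_on unit_disk"
  by (rule power_series_holomorphic[of 0 1 "\<lambda>n. complex_of_real (1 / (\<beta> n)\<^sup>2)"])
     (use generating_fun_sums in simp)

lemma taylor_coeff_generating_fun:
  "taylor_coeff (generating_fun \<beta>) n = complex_of_real (1 / (\<beta> n)\<^sup>2)"
  by (rule taylor_coeff_eqI) (rule generating_fun_sums)

lemma generating_fun_0: "generating_fun \<beta> 0 = 1"
  using taylor_coeff_simps(1)[OF generating_fun_holomorphic]
  by (simp add: taylor_coeff_generating_fun beta_0)

lemma deriv_generating_fun_0: "deriv (generating_fun \<beta>) 0 = complex_of_real (1 / (\<beta> 1)\<^sup>2)"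
  using taylor_coeff_simps(2)[OF generating_fun_holomorphic]
  by (simp add: taylor_coeff_generating_fun)

lemma generating_fun_cnj:
  "z \<in> unit_disk \<Longrightarrow> cnj (generating_fun \<beta> z) = generating_fun \<beta> (cnj z)"
  by (rule cnj_of_real_taylor_coeffs[OF generating_fun_holomorphic])
     (simp_all add: taylor_coeff_generating_fun)

lemma kernel_fun_holomorphic:
  "w \<in> unit_disk \<Longrightarrow> (\<lambda>z. generating_fun \<beta> (cnj w * z)) holomorphic_on unit_disk"
  by (rule dilate_holomorphic[OF generating_fun_holomorphic])

lemma coord_kernel_fun:
  assumes "w \<in> unit_disk" shows "coord (kernel_fun w) = kernel_coord w"
proof -
  have "taylor_coeff (kernel_fun w) n = complex_of_real (1 / (\<beta> n)\<^sup>2) * cnj w ^ n" for n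
  proof (rule taylor_coeff_eqI)
    fix z :: complex assume z: "z \<in> unit_disk"
    show "(\<lambda>n. complex_of_real (1 / (\<beta> n)\<^sup>2) * cnj w ^ n * z ^ n) sums kernel_fun w z"
      using generating_fun_sums[OF mult_unit_disk[OF z assms]] z
      by (simp add: kernel_fun_def on_disk_apply power_mult_distrib mult.assoc)
  qed
  then show ?thesis
    by (auto simp: coord_def kernel_coord_def power2_eq_square)
qed

lemma kernel_fun_in_hardy:
  assumes "w \<in> unit_disk" shows "kernel_fun w \<in> weighted_hardy \<beta>"
  using kernel_fun_holomorphic[OF assms] coord_kernel_fun[OF assms]
    square_summable_kernel_coord[OF assms]
  by (auto simp: weighted_hardy_iff kernel_fun_def on_disk_def intro: holomorphic_transform)

lemma wh_inner_kernel_fun: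
  assumes "f \<in> weighted_hardy \<beta>" "w \<in> unit_disk"
  shows "wh_inner \<beta> f (kernel_fun w) = f w"
  using assms
  by (simp add: wh_inner_eq coord_kernel_fun l2_inner_kernel_coord weighted_hardy_iff)

lemma kernel_coord_inner:
  assumes "x \<in> unit_disk" "y \<in> unit_disk"
  shows "l2_inner (kernel_coord x) (kernel_coord y) = generating_fun \<beta> (cnj x * y)"
  using wh_inner_kernel_fun[OF kernel_fun_in_hardy[OF assms(1)] assms(2)] assms
  by (simp add: wh_inner_eq coord_kernel_fun) (simp add: kernel_fun_def on_disk_apply)

abbreviation mono_fun :: "nat \<Rightarrow> complex \<Rightarrow> complex" where
  "mono_fun n \<equiv> on_disk (\<lambda>z. z ^ n)"

lemma taylor_coeff_mono_fun: "taylor_coeff (mono_fun n) m = (if m = n then 1 else 0)"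
proof (rule taylor_coeff_eqI)
  fix z :: complex assume "z \<in> unit_disk"
  then show "(\<lambda>m. (if m = n then 1 else 0) * z ^ m) sums mono_fun n z"
    using sums_single[of n "\<lambda>m. z ^ m"]
    by (simp add: on_disk_apply if_distrib[of "\<lambda>x. x * _"] cong: if_cong)
qed

lemma coord_mono_fun: "coord (mono_fun n) = (\<lambda>m. if m = n then complex_of_real (\<beta> n) else 0)"
  by (auto simp: coord_def taylor_coeff_mono_fun)

lemma mono_fun_in_hardy: "mono_fun n \<in> weighted_hardy \<beta>"
proof -
  have "summable (\<lambda>m. if m = n then (\<beta> n)\<^sup>2 else 0)"
    using sums_single[of n "\<lambda>_. (\<beta> n)\<^sup>2"] by (simp add: sums_iff)
  then have "square_summable (coord (mono_fun n))"
    by (simp add: coord_mono_fun square_summable_def if_distrib[of cmod] 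
          if_distrib[of "\<lambda>x. x\<^sup>2"] cong: if_cong)
  then show ?thesis
    by (auto simp: weighted_hardy_iff on_disk_def intro!: holomorphic_intros
        holomorphic_transform[of "\<lambda>z. z ^ n"])
qed

lemma wh_inner_mono_fun:
  "wh_inner \<beta> f (mono_fun n) = taylor_coeff f n * complex_of_real ((\<beta> n)\<^sup>2)"
proof -
  have "(\<lambda>m. coord f m * cnj (coord (mono_fun n) m)) = (\<lambda>m. if m = n then coord f n * \<beta> n else 0)"
    by (auto simp: coord_mono_fun)
  then show ?thesis
    using sums_single[of n "\<lambda>m. coord f n * \<beta> n"]
    by (simp add: wh_inner_eq l2_inner_def sums_iff) (simp add: coord_def power2_eq_square)
qed

end

section \<open>Density of the kernels\<close>

text \<open>The discrete Fourier transform on \<open>M\<close> points recovers a coefficient only up to the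
  index modulo \<open>M\<close>, which is why \<open>m\<close> is reduced here while \<open>n\<close> is restricted.\<close>

lemma cis_root_orthogonality:
  fixes M n m :: nat
  assumes "0 < M" "n < M"
  shows "(\<Sum>j<M. cis (2 * pi / M) ^ (j * n) * cnj (cis (2 * pi / M)) ^ (j * m))
       = (if n = m mod M then of_nat M else 0)"
proof -
  define om where "om = cis (2 * pi / M)"
  have om0: "om \<noteq> 0" by (simp add: om_def)
  have cnj_om: "cnj om = inverse om" by (simp add: om_def cis_cnj)
  have "om ^ M = cis (real M * (2 * pi / M))"
    unfolding om_def by (rule Complex.DeMoivre)
  then have omM: "om ^ M = 1" using assms by simp
  have red: "om ^ m = om ^ (m mod M)"
  proof -
    have "om ^ m = om ^ (M * (m div M) + m mod M)" by simp
    also have "\<dots> = om ^ (m mod M)" by (simp only: power_add power_mult omM) simp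
    finally show ?thesis .
  qed
  define x where "x = om ^ n * inverse om ^ m"
  have xM: "x ^ M = 1"
  proof -
    have "x ^ M = (om ^ M) ^ n * inverse (om ^ M) ^ m"
      by (simp add: x_def power_mult_distrib flip: power_mult power_inverse) (simp add: mult.commute)
    then show ?thesis by (simp add: omM)
  qed
  have x1: "x = 1 \<longleftrightarrow> n = m mod M"
  proof
    assume "x = 1"
    then have "om ^ n = om ^ (m mod M)"
      unfolding red[symmetric] x_def using om0 by (simp add: field_simps power_inverse)
    then have "cis (2 * pi * real n / real M) = cis (2 * pi * real (m mod M) / real M)"
      by (simp add: om_def Complex.DeMoivre mult.commute)
    then show "n = m mod M"
      using Complex.bij_betw_roots_unity[OF assms(1)] assms
      by (auto simp: bij_betw_def inj_on_def)
  next
    assume "n = m mod M"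
    then have "om ^ n = om ^ m" using red by simp
    then show "x = 1" using om0 by (simp add: x_def field_simps power_inverse)
  qed
  have "(\<Sum>j<M. om ^ (j * n) * cnj om ^ (j * m)) = (\<Sum>j<M. x ^ j)"
    by (intro sum.cong refl)
       (simp add: x_def cnj_om power_mult_distrib flip: power_mult, simp add: mult.commute)
  also have "\<dots> = (if n = m mod M then of_nat M else 0)"
    using x1 xM by (auto simp: geometric_sum)
  finally show ?thesis by (simp add: om_def)
qed

context weighted_hardy_space begin

text \<open>A functional criterion for membership in the space: if point evaluations of \<open>F\<close> are
  dominated by the norms of the corresponding combinations of kernels, then \<open>F\<close> acts boundedly on
  the span of the kernels, and this span is dense. Density is made explicit: averages of kernels at
  the points \<open>r * \<omega> ^ j\<close>, with \<open>\<omega>\<close> a primitive root of unity of order \<open>M\<close>, reproduce a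
  prescribed polynomial up to terms of degree at least \<open>M\<close>. These terms vanish as
  \<open>M\<close> grows, by Tannery's theorem.\<close>

lemma coord_bounded_by_point_evaluations:
  assumes F: "F holomorphic_on unit_disk" and B: "0 \<le> B"
    and bound: "\<And>(M::nat) c w. (\<And>j. j < M \<Longrightarrow> w j \<in> unit_disk) \<Longrightarrow>
       (cmod (\<Sum>j<M. cnj (c j) * F (w j)))\<^sup>2
         \<le> B * l2_normsq (\<lambda>n. \<Sum>j<M. c j * kernel_coord (w j) n)"
  shows "square_summable (coord F)" "l2_normsq (coord F) \<le> B"
proof -
  \<comment> \<open>The sample points lie on a circle whose radius only has to be in \<open>(0, 1)\<close>.\<close>
  define r :: real where "r = 1 / 2"
  have r: "0 < r" "r < 1" by (simp_all add: r_def)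
  have partial: "(\<Sum>n<N. (cmod (coord F n))\<^sup>2) \<le> B" if N: "0 < N" for N
  proof -
    define S where "S = (\<Sum>n<N. (cmod (coord F n))\<^sup>2)"
    \<comment> \<open>With this target \<open>\<gamma>\<close> both sides of the hypothesis tend to expressions in the partial sum
      \<open>S\<close>, namely to \<open>S\<^sup>2\<close> and \<open>B * S\<close>.\<close>
    define \<gamma> where "\<gamma> n = (if n < N then taylor_coeff F n * complex_of_real ((\<beta> n)\<^sup>2 / r ^ n) else 0)" for n
    define \<Gamma> where "\<Gamma> = (\<Sum>n<N. cmod (\<gamma> n))"
    have \<gamma>_le: "cmod (\<gamma> n) \<le> \<Gamma>" for n
    proof (cases "n < N")
      case True
      then show ?thesis unfolding \<Gamma>_def by (intro member_le_sum) auto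
    qed (simp add: \<gamma>_def \<Gamma>_def sum_nonneg)
    \<comment> \<open>The inverse discrete Fourier transform of \<open>\<gamma>\<close>, truncated at \<open>M\<close>.\<close>
    define c where "c M j = 1 / of_nat M * (\<Sum>n<M. \<gamma> n * cis (2 * pi / M) ^ (j * n))" for M j
    define w where "w M j = complex_of_real r * cis (2 * pi / M) ^ j" for M j :: nat
    have w_norm: "cmod (w M j) = r" for M j
      using r by (simp add: w_def norm_mult norm_power)
    have w_disk: "w M j \<in> unit_disk" for M j
      using r by (simp add: w_norm)
    have moment: "(\<Sum>j<M. c M j * cnj (w M j) ^ m) = r ^ m * \<gamma> (m mod M)" if "0 < M" for M m
    proof -
      let ?om = "cis (2 * pi / M)"
      have "(\<Sum>j<M. c M j * cnj (w M j) ^ m)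
          = (\<Sum>j<M. \<Sum>n<M. r ^ m / of_nat M * \<gamma> n * (?om ^ (j * n) * cnj ?om ^ (j * m)))"
        unfolding c_def w_def sum_distrib_left sum_distrib_right
        by (intro sum.cong refl) (simp add: power_mult_distrib mult_ac flip: power_mult)
      also have "\<dots> = (\<Sum>n<M. r ^ m / of_nat M * \<gamma> n *
                        (\<Sum>j<M. ?om ^ (j * n) * cnj ?om ^ (j * m)))"
        by (subst sum.swap) (simp add: sum_distrib_left)
      also have "\<dots> = (\<Sum>n<M. if n = m mod M then r ^ m * \<gamma> n else 0)"
        using that by (intro sum.cong refl) (simp add: cis_root_orthogonality)
      also have "\<dots> = r ^ m * \<gamma> (m mod M)"
        using that by simp
      finally show ?thesis .
    qed
    define L where "L M = (\<Sum>n. taylor_coeff F n * r ^ n * cnj (\<gamma> (n mod M)))" for M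
    define R where "R M = (\<Sum>n. r ^ (2 * n) / (\<beta> n)\<^sup>2 * (cmod (\<gamma> (n mod M)))\<^sup>2)" for M
    have LR: "(cmod (L M))\<^sup>2 \<le> B * R M" if M: "0 < M" for M
    proof -
      have "(\<lambda>n. \<Sum>j<M. cnj (c M j) * (taylor_coeff F n * w M j ^ n))
              sums (\<Sum>j<M. cnj (c M j) * F (w M j))"
        by (intro sums_sum sums_mult taylor_coeff_sums F w_disk)
      moreover have "(\<Sum>j<M. cnj (c M j) * (taylor_coeff F n * w M j ^ n))
            = taylor_coeff F n * r ^ n * cnj (\<gamma> (n mod M))" for n
      proof -
        have "(\<Sum>j<M. cnj (c M j) * (taylor_coeff F n * w M j ^ n))
           = taylor_coeff F n * cnj (\<Sum>j<M. c M j * cnj (w M j) ^ n)"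
          by (simp add: sum_distrib_left mult_ac)
        then show ?thesis by (simp add: moment[OF M])
      qed
      ultimately have "L M = (\<Sum>j<M. cnj (c M j) * F (w M j))"
        by (simp add: L_def sums_iff)
      moreover have "l2_normsq (\<lambda>n. \<Sum>j<M. c M j * kernel_coord (w M j) n) = R M"
      proof -
        have "(\<Sum>j<M. c M j * kernel_coord (w M j) n) = r ^ n * \<gamma> (n mod M) / \<beta> n" for n
          unfolding kernel_coord_def moment[OF M, symmetric] by (simp add: sum_divide_distrib)
        then show ?thesis using r
          by (simp add: l2_normsq_def R_def norm_mult norm_divide norm_power power_mult_distrib
              power_divide beta_pos mult.commute flip: power_mult)
      qed
      ultimately show ?thesis using bound[of M "w M" "c M"] w_disk by simp
    qed
    have ev: "eventually (\<lambda>M. \<gamma> (n mod M) = \<gamma> n) sequentially" for n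
      using eventually_gt_at_top[of n] by eventually_elim simp
    have "L \<longlonglongrightarrow> (\<Sum>n. taylor_coeff F n * r ^ n * cnj (\<gamma> n))"
      unfolding L_def
    proof (rule conjunct2[OF conjunct2[OF tannerys_theorem]])
      show "summable (\<lambda>n. cmod (taylor_coeff F n * r ^ n) * \<Gamma>)"
      proof (intro summable_mult2)
        obtain z where z: "z \<in> unit_disk" "cmod (of_real r) < cmod z"
          using r dense[of r 1] by (metis mem_ball_0 norm_of_real abs_of_pos order_less_trans)
        show "summable (\<lambda>n. cmod (taylor_coeff F n * r ^ n))"
          using powser_insidea[OF sums_summable[OF taylor_coeff_sums[OF F z(1)]] z(2)] by simp
      qed
      show "eventually (\<lambda>(n, M). norm (taylor_coeff F n * r ^ n * cnj (\<gamma> (n mod M)))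
              \<le> cmod (taylor_coeff F n * r ^ n) * \<Gamma>) (at_top \<times>\<^sub>F sequentially)"
        by (intro always_eventually) (auto simp: norm_mult intro!: mult_left_mono \<gamma>_le)
      show "(\<lambda>M. taylor_coeff F n * r ^ n * cnj (\<gamma> (n mod M)))
              \<longlonglongrightarrow> taylor_coeff F n * r ^ n * cnj (\<gamma> n)" for n
        by (rule tendsto_eventually) (use ev[of n] in \<open>eventually_elim, simp\<close>)
    qed auto
    also have "(\<Sum>n. taylor_coeff F n * r ^ n * cnj (\<gamma> n)) = (\<Sum>n<N. taylor_coeff F n * r ^ n * cnj (\<gamma> n))"
      by (intro suminf_finite) (auto simp: \<gamma>_def)
    also have "\<dots> = complex_of_real S"
      unfolding S_def of_real_sum
    proof (intro sum.cong refl)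
      fix n assume "n \<in> {..<N}"
      then show "taylor_coeff F n * r ^ n * cnj (\<gamma> n) = complex_of_real ((cmod (coord F n))\<^sup>2)"
        using r unfolding complex_norm_square
        by (simp add: \<gamma>_def coord_def power2_eq_square mult_ac)
    qed
    finally have L_lim: "L \<longlonglongrightarrow> complex_of_real S" .
    have "R \<longlonglongrightarrow> (\<Sum>n. r ^ (2 * n) / (\<beta> n)\<^sup>2 * (cmod (\<gamma> n))\<^sup>2)"
      unfolding R_def
    proof (rule conjunct2[OF conjunct2[OF tannerys_theorem]])
      have "r\<^sup>2 < 1" using r by (simp add: power_less_one_iff)
      then show "summable (\<lambda>n. r ^ (2 * n) / (\<beta> n)\<^sup>2 * \<Gamma>\<^sup>2)"
        using summable_kernel_series[of "r\<^sup>2"] by (intro summable_mult2) (simp add: power_mult)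
      show "eventually (\<lambda>(n, M). norm (r ^ (2 * n) / (\<beta> n)\<^sup>2 * (cmod (\<gamma> (n mod M)))\<^sup>2)
              \<le> r ^ (2 * n) / (\<beta> n)\<^sup>2 * \<Gamma>\<^sup>2) (at_top \<times>\<^sub>F sequentially)"
        by (intro always_eventually)
           (auto simp: abs_mult power_mult intro!: divide_right_mono mult_left_mono power_mono \<gamma>_le)
      show "(\<lambda>M. r ^ (2 * n) / (\<beta> n)\<^sup>2 * (cmod (\<gamma> (n mod M)))\<^sup>2)
              \<longlonglongrightarrow> r ^ (2 * n) / (\<beta> n)\<^sup>2 * (cmod (\<gamma> n))\<^sup>2" for n
        by (rule tendsto_eventually) (use ev[of n] in \<open>eventually_elim, simp\<close>)
    qed auto
    also have "(\<Sum>n. r ^ (2 * n) / (\<beta> n)\<^sup>2 * (cmod (\<gamma> n))\<^sup>2)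
        = (\<Sum>n<N. r ^ (2 * n) / (\<beta> n)\<^sup>2 * (cmod (\<gamma> n))\<^sup>2)"
      by (intro suminf_finite) (auto simp: \<gamma>_def)
    also have "\<dots> = S"
      unfolding S_def
    proof (intro sum.cong refl)
      fix n assume "n \<in> {..<N}"
      then show "r ^ (2 * n) / (\<beta> n)\<^sup>2 * (cmod (\<gamma> n))\<^sup>2 = (cmod (coord F n))\<^sup>2"
        using r beta_pos[of n]
        by (simp add: \<gamma>_def coord_def norm_mult norm_divide norm_power power_mult_distrib
            power_divide power_mult abs_mult)
           (simp add: field_simps power2_eq_square power4_eq_xxxx)
    qed
    finally have R_lim: "R \<longlonglongrightarrow> S" .
    have "(cmod (complex_of_real S))\<^sup>2 \<le> B * S"
    proof (rule tendsto_le)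
      show "(\<lambda>M. B * R M) \<longlonglongrightarrow> B * S" by (intro tendsto_intros R_lim)
      show "(\<lambda>M. (cmod (L M))\<^sup>2) \<longlonglongrightarrow> (cmod (complex_of_real S))\<^sup>2"
        by (intro tendsto_intros L_lim)
      show "eventually (\<lambda>M. (cmod (L M))\<^sup>2 \<le> B * R M) sequentially"
        using eventually_gt_at_top[of 0] by eventually_elim (rule LR)
    qed auto
    then have "S * S \<le> B * S" by (simp add: power2_eq_square)
    moreover have "0 \<le> S" by (simp add: S_def sum_nonneg)
    ultimately show ?thesis
      unfolding S_def[symmetric] using B by (cases "S = 0") auto
  qed
  have partial': "(\<Sum>n<N. (cmod (coord F n))\<^sup>2) \<le> B" for N
    using partial[of N] B by (cases N) auto
  show "square_summable (coord F)"
    unfolding square_summable_def using partial' by (intro summableI_nonneg_bounded) auto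
  then show "l2_normsq (coord F) \<le> B"
    unfolding l2_normsq_def square_summable_def using partial' by (intro suminf_le_const)
qed

section \<open>Bounded functionals and adjoints\<close>

definition poly_fun :: "(nat \<Rightarrow> complex) \<Rightarrow> nat \<Rightarrow> complex \<Rightarrow> complex" where
  "poly_fun a N = (\<lambda>z. \<Sum>n<N. a n * mono_fun n z)"

lemma zero_in_hardy: "(\<lambda>z. 0) \<in> weighted_hardy \<beta>" "coord (\<lambda>z. 0) = (\<lambda>n. 0)"
  using hardy_scale[OF mono_fun_in_hardy, of 0] by simp_all

lemma poly_fun_in_hardy:
  "poly_fun a N \<in> weighted_hardy \<beta>"
  "coord (poly_fun a N) = (\<lambda>n. if n < N then a n * complex_of_real (\<beta> n) else 0)"
proof (induction N)
  case 0
  {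
    case 1 then show ?case by (simp add: poly_fun_def zero_in_hardy)
  next
    case 2 then show ?case by (simp add: poly_fun_def zero_in_hardy)
  }
next
  case (Suc N)
  have eq: "poly_fun a (Suc N) = (\<lambda>z. poly_fun a N z + a N * mono_fun N z)"
    by (simp add: poly_fun_def)
  {
    case 1 show ?case
      unfolding eq by (intro hardy_add hardy_scale mono_fun_in_hardy Suc)
  next
    case 2 show ?case
      unfolding eq hardy_add(2)[OF Suc(1) hardy_scale(1)[OF mono_fun_in_hardy]]
        hardy_scale(2)[OF mono_fun_in_hardy] Suc(2) coord_mono_fun
      by (auto simp: less_Suc_eq)
  }
qed

text \<open>The Riesz representation theorem in this space. The orthogonal basis of monomials
  gives the representing function directly, and boundedness of the functional on its Taylor
  polynomials shows that this function has finite norm.\<close>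

lemma bounded_functional_representation:
  assumes add: "\<And>f g. f \<in> weighted_hardy \<beta> \<Longrightarrow> g \<in> weighted_hardy \<beta> \<Longrightarrow>
      L (\<lambda>z. f z + g z) = L f + L g"
    and scale: "\<And>a f. f \<in> weighted_hardy \<beta> \<Longrightarrow> L (\<lambda>z. a * f z) = a * L f"
    and bound: "\<And>f. f \<in> weighted_hardy \<beta> \<Longrightarrow> cmod (L f) \<le> C * wh_norm \<beta> f"
  obtains h where "h \<in> weighted_hardy \<beta>" "\<And>f. f \<in> weighted_hardy \<beta> \<Longrightarrow> L f = wh_inner \<beta> f h"
proof -
  have L_poly: "L (poly_fun a N) = (\<Sum>n<N. a n * L (mono_fun n))" for a N
  proof (induction N)
    case 0
    show ?case using scale[OF mono_fun_in_hardy, of 0] by (simp add: poly_fun_def)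
  next
    case (Suc N)
    have eq: "poly_fun a (Suc N) = (\<lambda>z. poly_fun a N z + a N * mono_fun N z)"
      by (simp add: poly_fun_def)
    show ?case
      unfolding eq
      by (simp add: Suc add scale poly_fun_in_hardy hardy_scale mono_fun_in_hardy)
  qed
  \<comment> \<open>The only possible coefficients, since the monomials are orthogonal.\<close>
  define a where "a n = cnj (L (mono_fun n)) / complex_of_real ((\<beta> n)\<^sup>2)" for n
  define x where "x n = a n * complex_of_real (\<beta> n)" for n
  have partial: "(\<Sum>n<N. (cmod (x n))\<^sup>2) \<le> C\<^sup>2" for N
  proof -
    define S where "S = (\<Sum>n<N. (cmod (x n))\<^sup>2)"
    have S0: "0 \<le> S" by (simp add: S_def sum_nonneg)
    have "l2_normsq (coord (poly_fun a N)) = (\<Sum>n. if n < N then (cmod (x n))\<^sup>2 else 0)"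
      unfolding poly_fun_in_hardy l2_normsq_def x_def by (intro suminf_cong) auto
    also have "\<dots> = S"
      unfolding S_def by (subst suminf_finite[of "{..<N}"]) auto
    finally have norm: "wh_norm \<beta> (poly_fun a N) = sqrt S"
      by (simp add: wh_norm_eq poly_fun_in_hardy)
    have "a n * L (mono_fun n) = complex_of_real ((cmod (x n))\<^sup>2)" for n
    proof -
      have "L (mono_fun n) = cnj (a n) * complex_of_real ((\<beta> n)\<^sup>2)"
        by (simp add: a_def)
      then show ?thesis
        unfolding complex_norm_square by (simp add: x_def power2_eq_square)
    qed
    then have "L (poly_fun a N) = complex_of_real S"
      by (simp add: L_poly S_def del: of_real_power)
    then have "S \<le> C * sqrt S"
      using bound[OF poly_fun_in_hardy(1), of a N] S0 by (simp add: norm)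
    also have "\<dots> \<le> \<bar>C\<bar> * sqrt S"
      using S0 by (intro mult_right_mono) auto
    finally have "sqrt S * sqrt S \<le> \<bar>C\<bar> * sqrt S"
      using S0 by simp
    then have "sqrt S \<le> \<bar>C\<bar>"
      using S0 mult_right_le_imp_le[of "sqrt S" "sqrt S" "\<bar>C\<bar>"] by (cases "S = 0") auto
    then have "(sqrt S)\<^sup>2 \<le> \<bar>C\<bar>\<^sup>2"
      using S0 by (intro power_mono) auto
    then show ?thesis
      using S0 by (simp add: S_def)
  qed
  then have sq: "square_summable (\<lambda>n. x n)"
    unfolding square_summable_def by (intro summableI_nonneg_bounded) auto
  define h where "h = on_disk (\<lambda>z. \<Sum>n. a n * z ^ n)"
  have h: "h \<in> weighted_hardy \<beta>" "coord h = x"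
    using power_series_in_hardy[OF sq[unfolded x_def]]
    by (auto simp: h_def coord_def x_def fun_eq_iff)
  show ?thesis
  proof (rule that[OF h(1)])
    fix f assume f: "f \<in> weighted_hardy \<beta>"
    then have sqf: "square_summable (coord f)" by (simp add: weighted_hardy_iff)
    define p where "p N = poly_fun (taylor_coeff f) N" for N
    have "(\<lambda>n. coord f n * cnj (coord h n)) sums wh_inner \<beta> f h"
      unfolding wh_inner_eq l2_inner_def
      using sqf h by (intro summable_sums summable_l2_inner) (auto simp: weighted_hardy_iff)
    moreover have "coord f n * cnj (coord h n) = taylor_coeff f n * L (mono_fun n)" for n
      by (simp add: h coord_def x_def a_def power2_eq_square)
    ultimately have lim1: "(\<lambda>N. L (p N)) \<longlonglongrightarrow> wh_inner \<beta> f h"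
      by (simp add: p_def L_poly sums_def)
    \<comment> \<open>The Taylor polynomials of \<open>f\<close> converge to \<open>f\<close> in norm, so that \<open>L\<close> passes to the limit.\<close>
    have "(\<lambda>N. L f - L (p N)) \<longlonglongrightarrow> 0"
    proof (rule Lim_null_comparison)
      define tail where "tail N = l2_normsq (coord f) - (\<Sum>n<N. (cmod (coord f n))\<^sup>2)" for N
      have "(\<lambda>N. \<Sum>n<N. (cmod (coord f n))\<^sup>2) \<longlonglongrightarrow> l2_normsq (coord f)"
        using sqf unfolding l2_normsq_def square_summable_def by (rule summable_LIMSEQ)
      from tendsto_diff[OF tendsto_const[of "l2_normsq (coord f)"] this]
      have "tail \<longlonglongrightarrow> 0" by (simp add: tail_def[abs_def])
      from tendsto_mult[OF tendsto_const[of C] tendsto_real_sqrt[OF this]]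
      show "(\<lambda>N. C * sqrt (tail N)) \<longlonglongrightarrow> 0" by simp
      have "cmod (L f - L (p N)) \<le> C * sqrt (tail N)" for N
      proof -
        define d where "d = (\<lambda>z. f z + (- 1) * p N z)"
        have d: "d \<in> weighted_hardy \<beta>"
          unfolding d_def p_def by (intro hardy_add hardy_scale f poly_fun_in_hardy)
        have "coord d = (\<lambda>n. if n < N then 0 else coord f n)"
          unfolding d_def p_def
            hardy_add(2)[OF f hardy_scale(1)[OF poly_fun_in_hardy(1)]]
            hardy_scale(2)[OF poly_fun_in_hardy(1)] poly_fun_in_hardy(2)
          by (auto simp: coord_def)
        then have eq: "(\<lambda>n. (cmod (coord d n))\<^sup>2)
            = (\<lambda>n. (cmod (coord f n))\<^sup>2 - (if n < N then (cmod (coord f n))\<^sup>2 else 0))"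
          by auto
        have "(\<lambda>n. if n < N then (cmod (coord f n))\<^sup>2 else 0) sums (\<Sum>n<N. (cmod (coord f n))\<^sup>2)"
          using sums_If_finite_set[of "{..<N}" "\<lambda>n. (cmod (coord f n))\<^sup>2"] by simp
        moreover have "(\<lambda>n. (cmod (coord f n))\<^sup>2) sums l2_normsq (coord f)"
          using sqf unfolding l2_normsq_def square_summable_def by (rule summable_sums)
        ultimately have "(\<lambda>n. (cmod (coord d n))\<^sup>2) sums tail N"
          unfolding eq tail_def by (intro sums_diff)
        then have "l2_normsq (coord d) = tail N"
          by (simp add: l2_normsq_def sums_iff)
        have "L d = L f - L (p N)"
          unfolding d_def p_def
          by (simp only: add[OF f hardy_scale(1)[OF poly_fun_in_hardy(1)]]
              scale[OF poly_fun_in_hardy(1)]) simp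
        with \<open>l2_normsq (coord d) = tail N\<close> show ?thesis
          using bound[OF d] by (simp add: wh_norm_eq d)
      qed
      then show "eventually (\<lambda>N. norm (L f - L (p N)) \<le> C * sqrt (tail N)) sequentially"
        by simp
    qed
    from tendsto_add[OF this lim1] have "(\<lambda>N. L f) \<longlonglongrightarrow> wh_inner \<beta> f h"
      by simp
    then show "L f = wh_inner \<beta> f h"
      by (simp add: LIMSEQ_const_iff)
  qed
qed

text \<open>The adjoint is specified by definite description; testing on the kernels shows that at most
  one function satisfies it.\<close>

lemma wh_adjoint_eqI:
  assumes h: "h \<in> weighted_hardy \<beta>"
    and eq: "\<And>f. f \<in> weighted_hardy \<beta> \<Longrightarrow> wh_inner \<beta> (T f) g = wh_inner \<beta> f h"
  shows "wh_adjoint \<beta> T g = h"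
  unfolding wh_adjoint_def
proof (rule the_equality)
  show "h \<in> weighted_hardy \<beta> \<and> (\<forall>f\<in>weighted_hardy \<beta>. wh_inner \<beta> (T f) g = wh_inner \<beta> f h)"
    using assms by blast
next
  fix h' assume h': "h' \<in> weighted_hardy \<beta> \<and>
      (\<forall>f\<in>weighted_hardy \<beta>. wh_inner \<beta> (T f) g = wh_inner \<beta> f h')"
  show "h' = h"
  proof (rule hardy_eqI)
    fix z :: complex assume z: "z \<in> unit_disk"
    have "wh_inner \<beta> (kernel_fun z) h' = wh_inner \<beta> (kernel_fun z) h"
      using h' eq kernel_fun_in_hardy[OF z] by simp
    then have "cnj (wh_inner \<beta> h' (kernel_fun z)) = cnj (wh_inner \<beta> h (kernel_fun z))"
      using h h' kernel_fun_in_hardy[OF z] by (simp add: wh_inner_commute[symmetric])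
    then show "h' z = h z"
      using h h' z by (simp add: wh_inner_kernel_fun)
  qed (use h h' in auto)
qed

lemma weighted_comp_add:
  "weighted_comp \<psi> \<phi> (\<lambda>z. f z + g z) = (\<lambda>z. weighted_comp \<psi> \<phi> f z + weighted_comp \<psi> \<phi> g z)"
  by (auto simp: weighted_comp_def on_disk_def ring_distribs)

lemma weighted_comp_scale:
  "weighted_comp \<psi> \<phi> (\<lambda>z. a * f z) = (\<lambda>z. a * weighted_comp \<psi> \<phi> f z)"
  by (auto simp: weighted_comp_def on_disk_def)

text \<open>Existence of the adjoint, so that the definite description denotes.\<close>

lemma wh_adjoint_weighted_comp:
  assumes bounded: "wh_bounded \<beta> (weighted_comp \<psi> \<phi>)" and g: "g \<in> weighted_hardy \<beta>"
  shows "wh_adjoint \<beta> (weighted_comp \<psi> \<phi>) g \<in> weighted_hardy \<beta>"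
    and "f \<in> weighted_hardy \<beta> \<Longrightarrow> wh_inner \<beta> (weighted_comp \<psi> \<phi> f) g
           = wh_inner \<beta> f (wh_adjoint \<beta> (weighted_comp \<psi> \<phi>) g)"
proof -
  let ?T = "weighted_comp \<psi> \<phi>"
  have T: "?T f \<in> weighted_hardy \<beta>" if "f \<in> weighted_hardy \<beta>" for f
    using bounded that by (auto simp: wh_bounded_def)
  obtain C where C: "\<And>f. f \<in> weighted_hardy \<beta> \<Longrightarrow> wh_norm \<beta> (?T f) \<le> C * wh_norm \<beta> f"
    using bounded by (auto simp: wh_bounded_def)
  have g2: "square_summable (coord g)" using g by (simp add: weighted_hardy_iff)
  obtain h where h: "h \<in> weighted_hardy \<beta>"
    "\<And>f. f \<in> weighted_hardy \<beta> \<Longrightarrow> wh_inner \<beta> (?T f) g = wh_inner \<beta> f h"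
  proof (rule bounded_functional_representation[of "\<lambda>f. wh_inner \<beta> (?T f) g" "C * wh_norm \<beta> g"])
    fix f f' assume f: "f \<in> weighted_hardy \<beta>" "f' \<in> weighted_hardy \<beta>"
    have "square_summable (coord (?T f))" "square_summable (coord (?T f'))"
      using T f by (auto simp: weighted_hardy_iff)
    then show "wh_inner \<beta> (?T (\<lambda>z. f z + f' z)) g = wh_inner \<beta> (?T f) g + wh_inner \<beta> (?T f') g"
      unfolding weighted_comp_add wh_inner_eq hardy_add(2)[OF T T, OF f] l2_inner_def
      by (subst suminf_add) (auto intro!: summable_l2_inner g2 simp: ring_distribs)
  next
    fix a f assume f: "f \<in> weighted_hardy \<beta>"
    have "square_summable (coord (?T f))"
      using T f by (auto simp: weighted_hardy_iff)
    then show "wh_inner \<beta> (?T (\<lambda>z. a * f z)) g = a * wh_inner \<beta> (?T f) g"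
      unfolding weighted_comp_scale wh_inner_eq hardy_scale(2)[OF T, OF f] l2_inner_def
      by (subst suminf_mult[symmetric]) (auto intro!: summable_l2_inner g2 simp: mult.assoc)
  next
    fix f assume f: "f \<in> weighted_hardy \<beta>"
    have "0 \<le> wh_norm \<beta> g"
      using g g2 by (simp add: wh_norm_eq l2_normsq_nonneg)
    from mult_right_mono[OF C[OF f] this] wh_Cauchy_Schwarz[OF T[OF f] g]
    show "cmod (wh_inner \<beta> (?T f) g) \<le> C * wh_norm \<beta> g * wh_norm \<beta> f"
      by (simp add: mult_ac)
  qed blast
  have "wh_adjoint \<beta> ?T g = h"
    by (rule wh_adjoint_eqI) (use h in auto)
  with h show "wh_adjoint \<beta> ?T g \<in> weighted_hardy \<beta>"
    and "f \<in> weighted_hardy \<beta> \<Longrightarrow> wh_inner \<beta> (?T f) g = wh_inner \<beta> f (wh_adjoint \<beta> ?T g)"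
    by auto
qed

end

section \<open>Operators that are symmetric on the kernels\<close>

text \<open>For \<open>h N = \<parallel>T ^ N u\<parallel>\<^sup>2\<close> with \<open>T\<close> symmetric, \<open>log_convex\<close> is the Cauchy-Schwarz
  inequality. The conclusion then says that a symmetric operator is bounded on a vector \<open>u\<close> by the
  growth rate of its powers on \<open>u\<close>, whatever the constant \<open>A\<close>; this independence of \<open>u\<close> is the point.\<close>

lemma first_step_bounded_by_growth_rate:
  fixes h :: "nat \<Rightarrow> real"
  assumes nonneg: "\<And>N. 0 \<le> h N"
    and log_convex: "\<And>N. (h N)\<^sup>2 \<le> h 0 * h (2 * N)"
    and growth: "\<And>N. h N \<le> A * D ^ N" and D: "0 < D"
  shows "h 1 \<le> D * h 0"
proof (cases "h 0 = 0")
  case True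
  then show ?thesis using log_convex[of 1] by simp
next
  case False
  then have h0: "0 < h 0" using nonneg[of 0] by simp
  define t where "t = h 1 / h 0"
  have t0: "0 \<le> t" using h0 nonneg by (simp add: t_def)
  \<comment> \<open>Repeated doubling turns \<open>h 1 = t * h 0\<close> into growth of rate at least \<open>t\<close> along powers of two.\<close>
  have lower: "t ^ (2 ^ n) * h 0 \<le> h (2 ^ n)" for n
  proof (induction n)
    case 0
    show ?case using h0 by (simp add: t_def)
  next
    case (Suc n)
    have "h 0 * (t ^ (2 ^ Suc n) * h 0) = (t ^ (2 ^ n) * h 0)\<^sup>2"
      by (simp add: power_mult_distrib power2_eq_square power_add mult_2)
    also have "\<dots> \<le> (h (2 ^ n))\<^sup>2"
      using Suc t0 h0 by (intro power_mono) auto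
    also have "\<dots> \<le> h 0 * h (2 ^ Suc n)"
      using log_convex[of "2 ^ n"] by simp
    finally show ?case using h0 by simp
  qed
  have "t \<le> D"
  proof (rule ccontr)
    assume "\<not> t \<le> D"
    then have x: "1 < t / D" using D by simp
    then obtain m where m: "A / h 0 < (t / D) ^ m" using real_arch_pow by blast
    also have "(t / D) ^ m \<le> (t / D) ^ (2 ^ m)"
      using x by (intro power_increasing) (auto intro: less_imp_le less_exp)
    also have "\<dots> \<le> A / h 0"
      using order_trans[OF lower[of m] growth[of "2 ^ m"]] D h0
      by (simp add: power_divide divide_simps mult.commute)
    finally show False by simp
  qed
  then show ?thesis using h0 by (simp add: t_def divide_simps)
qed

text \<open>A quantitative form of the Schwarz-Pick lemma: a selfmap brings points closer to the circle by
  at most a fixed factor, so its iterates approach the circle at most exponentially fast.\<close>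

lemma selfmap_defect_lower_bound:
  assumes hol: "\<phi> holomorphic_on unit_disk" and self: "\<phi> ` unit_disk \<subseteq> unit_disk"
    and z: "z \<in> unit_disk"
  shows "(1 - cmod (\<phi> 0)) / (1 + cmod (\<phi> 0)) * (1 - (cmod z)\<^sup>2) \<le> 1 - (cmod (\<phi> z))\<^sup>2"
proof -
  define a where "a = \<phi> 0"
  have disk: "cmod (\<phi> z) < 1" if "cmod z < 1" for z
    using self that by (auto simp: image_subset_iff)
  have a: "cmod a < 1" unfolding a_def by (rule disk) simp
  define g where "g = Moebius_function 0 a \<circ> \<phi>"
  have "cmod (g z) \<le> cmod z"
  proof (rule Schwarz_Lemma(1))
    show "g holomorphic_on ball 0 1"
      unfolding g_def using self
      by (intro holomorphic_on_compose_gen[OF hol Moebius_function_holomorphic[OF a]]) auto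
    show "g 0 = 0" by (simp add: g_def a_def Moebius_function_eq_zero)
    show "cmod (g z) < 1" if "cmod z < 1" for z
      unfolding g_def o_def by (intro Moebius_function_norm_lt_1 a disk that)
    show "cmod z < 1" using z by simp
  qed
  define w where "w = \<phi> z"
  have w: "cmod w < 1" unfolding w_def using z by (intro disk) simp
  define d where "d = cmod (1 - cnj a * w)"
  have "cmod (cnj a * w) \<le> cmod a * 1"
    unfolding norm_mult complex_mod_cnj using w by (intro mult_left_mono) auto
  then have d: "1 - cmod a \<le> d"
    using norm_triangle_ineq2[of 1 "cnj a * w"] by (simp add: d_def)
  have d0: "0 < d" using d a by simp
  have "cmod (w - a) \<le> cmod z * d"
    using \<open>cmod (g z) \<le> cmod z\<close> d0
    by (simp add: g_def Moebius_function_simple w_def d_def norm_divide divide_simps)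
  then have "(cmod (w - a))\<^sup>2 \<le> (cmod z * d)\<^sup>2"
    by (intro power_mono) auto
  \<comment> \<open>The identity behind the invariance of the disk under Moebius maps.\<close>
  moreover have "d\<^sup>2 - (cmod (w - a))\<^sup>2 = (1 - (cmod a)\<^sup>2) * (1 - (cmod w)\<^sup>2)"
    unfolding d_def cmod_power2 by (simp add: power2_eq_square algebra_simps)
  ultimately have "(1 - (cmod z)\<^sup>2) * d\<^sup>2 \<le> (1 - (cmod a)\<^sup>2) * (1 - (cmod w)\<^sup>2)"
    by (simp add: power_mult_distrib algebra_simps)
  moreover have "(1 - (cmod z)\<^sup>2) * (1 - cmod a)\<^sup>2 \<le> (1 - (cmod z)\<^sup>2) * d\<^sup>2"
    using d a z by (intro mult_left_mono power_mono) (auto simp: power_le_one)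
  ultimately have "(1 - cmod a) * ((1 - cmod a) * (1 - (cmod z)\<^sup>2))
      \<le> (1 - cmod a) * ((1 + cmod a) * (1 - (cmod w)\<^sup>2))"
    by (simp add: power2_eq_square algebra_simps)
  then have "(1 - cmod a) * (1 - (cmod z)\<^sup>2) \<le> (1 + cmod a) * (1 - (cmod w)\<^sup>2)"
    using a by simp
  moreover have "0 < 1 + cmod a" by (simp add: add_pos_nonneg)
  ultimately show ?thesis
    by (simp add: w_def a_def divide_simps mult_ac)
qed

context weighted_hardy_space begin

text \<open>The hypothesis \<open>symmetric\<close> says that the operator sends the kernel at \<open>w\<close> to
  \<open>cnj (\<psi> w)\<close> times the kernel at \<open>\<phi> w\<close>, which is also what its adjoint would do. Thus it maps the
  span of the kernels to itself symmetrically. The norms of the iterates of a fixed combination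
  grow at most exponentially: the factors \<open>\<psi>\<close> are bounded, the points approach the circle at most
  exponentially fast, and the kernel grows polynomially there. The rate does not depend on the
  combination, so that it bounds the operator itself on the span.\<close>

lemma kernel_span_bound:
  fixes \<psi> \<phi> c w and m :: nat
  assumes self: "\<And>z. z \<in> unit_disk \<Longrightarrow> \<phi> z \<in> unit_disk"
    and symmetric: "\<And>z w. z \<in> unit_disk \<Longrightarrow> w \<in> unit_disk \<Longrightarrow>
      \<psi> z * generating_fun \<beta> (cnj w * \<phi> z) = cnj (\<psi> w) * generating_fun \<beta> (cnj (\<phi> w) * z)"
    and psi: "\<And>z. z \<in> unit_disk \<Longrightarrow> cmod (\<psi> z) \<le> M" and M: "0 < M"
    and defect: "\<And>z. z \<in> unit_disk \<Longrightarrow> q * (1 - (cmod z)\<^sup>2) \<le> 1 - (cmod (\<phi> z))\<^sup>2" and q: "0 < q"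
    and kernel: "\<And>u. u \<in> unit_disk \<Longrightarrow> cmod (generating_fun \<beta> u) \<le> B * (1 - cmod u) powr (- s)"
    and s: "0 \<le> s" and B: "0 \<le> B"
    and w: "\<And>j. j < m \<Longrightarrow> w j \<in> unit_disk"
  shows "l2_normsq (\<lambda>n. \<Sum>j<m. (c j * cnj (\<psi> (w j))) * kernel_coord (\<phi> (w j)) n)
    \<le> (M\<^sup>2 * q powr (- s)) * l2_normsq (\<lambda>n. \<Sum>j<m. c j * kernel_coord (w j) n)"
proof -
  let ?k = "generating_fun \<beta>"
  \<comment> \<open>\<open>u N\<close> is the image of \<open>u 0\<close> under the \<open>N\<close>-th power of the operator.\<close>
  define pt where "pt N j = (\<phi> ^^ N) (w j)" for N j
  define d where "d N j = c j * (\<Prod>i<N. cnj (\<psi> (pt i j)))" for N j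
  define u where "u N n = (\<Sum>j<m. d N j * kernel_coord (pt N j) n)" for N n
  define h where "h N = l2_normsq (u N)" for N
  have pt: "pt N j \<in> unit_disk" if "j < m" for N j
    by (induction N) (use w self that in \<open>auto simp: pt_def\<close>)
  have pt_Suc: "pt (Suc N) j = \<phi> (pt N j)" and d_Suc: "d (Suc N) j = d N j * cnj (\<psi> (pt N j))"
    for N j by (simp_all add: pt_def d_def mult_ac)
  have u2: "square_summable (u N)" for N
    unfolding u_def using pt by (intro square_summable_sum square_summable_kernel_coord) auto
  have gram: "l2_inner (u a) (u b)
      = (\<Sum>i<m. \<Sum>j<m. d a i * cnj (d b j) * ?k (cnj (pt a i) * pt b j))" for a b
  proof -
    have "l2_inner (u a) (u b) = (\<Sum>i<m. d a i * l2_inner (kernel_coord (pt a i)) (u b))"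
      unfolding u_def[of a, abs_def] using pt
      by (intro l2_inner_sum_left u2 square_summable_kernel_coord) auto
    also have "\<dots> = (\<Sum>i<m. d a i * (\<Sum>j<m. cnj (d b j) * ?k (cnj (pt a i) * pt b j)))"
    proof (intro sum.cong refl arg_cong[of _ _ "(*) _"])
      fix i assume "i \<in> {..<m}"
      then have i: "pt a i \<in> unit_disk" using pt by simp
      have "l2_inner (kernel_coord (pt a i)) (u b)
          = (\<Sum>j<m. cnj (d b j) * l2_inner (kernel_coord (pt a i)) (kernel_coord (pt b j)))"
        unfolding u_def[of b, abs_def] using pt i
        by (intro l2_inner_sum_right square_summable_kernel_coord) auto
      then show "l2_inner (kernel_coord (pt a i)) (u b)
          = (\<Sum>j<m. cnj (d b j) * ?k (cnj (pt a i) * pt b j))"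
        using pt i by (simp add: kernel_coord_inner)
    qed
    finally show ?thesis by (simp add: sum_distrib_left mult.assoc)
  qed
  have shift: "l2_inner (u (Suc a)) (u b) = l2_inner (u a) (u (Suc b))" for a b
    unfolding gram
  proof (intro sum.cong refl)
    fix i j assume "i \<in> {..<m}" "j \<in> {..<m}"
    then have "\<psi> (pt b j) * ?k (cnj (pt a i) * \<phi> (pt b j))
        = cnj (\<psi> (pt a i)) * ?k (cnj (\<phi> (pt a i)) * pt b j)"
      using symmetric pt by simp
    then show "d (Suc a) i * cnj (d b j) * ?k (cnj (pt (Suc a) i) * pt b j)
        = d a i * cnj (d (Suc b) j) * ?k (cnj (pt a i) * pt (Suc b) j)"
      by (simp add: pt_Suc d_Suc mult_ac)
  qed
  \<comment> \<open>Hence the Gram matrix of the orbit depends on the sum of the indices only.\<close>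
  have shift': "l2_inner (u a) (u b) = l2_inner (u 0) (u (a + b))" for a b
    by (induction a arbitrary: b) (simp_all add: shift)
  have h_eq: "complex_of_real (h N) = l2_inner (u N) (u N)" for N
    by (simp add: h_def l2_inner_self u2)
  have h_nonneg: "0 \<le> h N" for N by (simp add: h_def l2_normsq_nonneg u2)
  have h_norm: "h N = cmod (l2_inner (u N) (u N))" for N
    using h_nonneg[of N] by (simp flip: h_eq)
  have convex: "(h N)\<^sup>2 \<le> h 0 * h (2 * N)" for N
    using l2_Cauchy_Schwarz[OF u2[of 0] u2[of "2 * N"]]
    unfolding h_norm[of N] shift'[of N N] mult_2[symmetric] unfolding h_def .
  \<comment> \<open>A common lower bound for the finitely many \<open>1 - (cmod (w j))\<^sup>2\<close>; the extra 1 covers \<open>m = 0\<close>.\<close>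
  define \<delta> where "\<delta> = Min (insert 1 ((\<lambda>j. 1 - (cmod (w j))\<^sup>2) ` {..<m}))"
  have \<delta>: "0 < \<delta>"
    unfolding \<delta>_def using w by (subst Min_gr_iff) (auto simp: abs_square_less_1)
  have defect_pt: "q ^ N * \<delta> \<le> 1 - (cmod (pt N j))\<^sup>2" if j: "j < m" for N j
  proof (induction N)
    case 0
    show ?case unfolding \<delta>_def pt_def using j by (auto intro!: Min_le)
  next
    case (Suc N)
    have "q ^ Suc N * \<delta> \<le> q * (1 - (cmod (pt N j))\<^sup>2)"
      using mult_left_mono[OF Suc, of q] q by (simp add: mult.assoc)
    also have "\<dots> \<le> 1 - (cmod (pt (Suc N) j))\<^sup>2"
      unfolding pt_Suc by (intro defect pt j)
    finally show ?case .
  qed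
  have kernel_pt: "cmod (?k (cnj (pt N i) * pt N j)) \<le> B * \<delta> powr (- s) * (q powr (- s)) ^ N"
    if ij: "i < m" "j < m" for N i j
  proof -
    let ?v = "cnj (pt N i) * pt N j"
    have e: "0 < q ^ N * \<delta>" using q \<delta> by simp
    have "0 \<le> (cmod (pt N i) - cmod (pt N j))\<^sup>2" by simp
    then have "2 * cmod ?v \<le> (cmod (pt N i))\<^sup>2 + (cmod (pt N j))\<^sup>2"
      unfolding power2_diff norm_mult complex_mod_cnj by linarith
    then have "q ^ N * \<delta> \<le> 1 - cmod ?v"
      using defect_pt[OF ij(1), of N] defect_pt[OF ij(2), of N] by linarith
    then have "(1 - cmod ?v) powr (- s) \<le> (q ^ N * \<delta>) powr (- s)"
      using s e by (intro powr_mono2') auto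
    also have "\<dots> = \<delta> powr (- s) * (q powr (- s)) ^ N"
    proof -
      have "(q ^ N) powr (- s) = (q powr (- s)) ^ N"
        using q by (simp add: powr_powr mult.commute flip: powr_realpow)
      then show ?thesis using q \<delta> by (simp add: powr_mult)
    qed
    finally have "B * (1 - cmod ?v) powr (- s) \<le> B * (\<delta> powr (- s) * (q powr (- s)) ^ N)"
      using B by (intro mult_left_mono)
    then show ?thesis
      using kernel[OF mult_unit_disk[OF pt pt, OF ij(2) ij(1)], of N N] by (simp add: mult.assoc)
  qed
  have d_le: "cmod (d N j) \<le> cmod (c j) * M ^ N" if "j < m" for N j
  proof -
    have "(\<Prod>i<N. cmod (\<psi> (pt i j))) \<le> (\<Prod>i<N. M)"
      using psi pt that by (intro prod_mono) auto
    then show ?thesis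
      by (auto simp: d_def norm_mult prod_norm[symmetric] intro!: mult_left_mono)
  qed
  define A where "A = (\<Sum>i<m. \<Sum>j<m. cmod (c i) * cmod (c j) * (B * \<delta> powr (- s)))"
  have growth: "h N \<le> A * (M\<^sup>2 * q powr (- s)) ^ N" for N
  proof -
    have "h N \<le> (\<Sum>i<m. \<Sum>j<m. cmod (d N i * cnj (d N j) * ?k (cnj (pt N i) * pt N j)))"
      unfolding h_norm gram by (intro order_trans[OF norm_sum] sum_mono norm_sum)
    also have "\<dots> \<le> (\<Sum>i<m. \<Sum>j<m. (cmod (c i) * M ^ N) * (cmod (c j) * M ^ N)
        * (B * \<delta> powr (- s) * (q powr (- s)) ^ N))"
      unfolding norm_mult complex_mod_cnj using M B
      by (intro sum_mono mult_mono d_le kernel_pt[unfolded norm_mult complex_mod_cnj]) auto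
    also have "\<dots> = A * (M\<^sup>2 * q powr (- s)) ^ N"
      unfolding A_def sum_distrib_right
      by (intro sum.cong refl) (simp add: power_mult_distrib power2_eq_square mult_ac)
    finally show ?thesis .
  qed
  have "h 1 \<le> (M\<^sup>2 * q powr (- s)) * h 0"
    using h_nonneg convex growth by (rule first_step_bounded_by_growth_rate) (use M q in simp)
  moreover have "u 1 = (\<lambda>n. \<Sum>j<m. (c j * cnj (\<psi> (w j))) * kernel_coord (\<phi> (w j)) n)"
    by (auto simp: u_def d_def pt_def)
  moreover have "u 0 = (\<lambda>n. \<Sum>j<m. c j * kernel_coord (w j) n)"
    by (auto simp: u_def d_def pt_def)
  ultimately show ?thesis by (simp add: h_def)
qed

text \<open>Boundedness on the span of the kernels carries over to the whole space by duality: by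
  symmetry, the evaluations of the image of \<open>f\<close> are inner products of \<open>f\<close> with images of kernels.\<close>

lemma wh_bounded_if_symmetric:
  assumes hol: "\<psi> holomorphic_on unit_disk" "\<phi> holomorphic_on unit_disk"
    and self: "\<phi> ` unit_disk \<subseteq> unit_disk"
    and symmetric: "\<And>z w. z \<in> unit_disk \<Longrightarrow> w \<in> unit_disk \<Longrightarrow>
      \<psi> z * generating_fun \<beta> (cnj w * \<phi> z) = cnj (\<psi> w) * generating_fun \<beta> (cnj (\<phi> w) * z)"
    and psi: "\<And>z. z \<in> unit_disk \<Longrightarrow> cmod (\<psi> z) \<le> M"
    and kernel: "\<And>u. u \<in> unit_disk \<Longrightarrow> cmod (generating_fun \<beta> u) \<le> B * (1 - cmod u) powr (- s)"
    and s: "0 \<le> s"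
  shows "wh_bounded \<beta> (weighted_comp \<psi> \<phi>)"
proof -
  define q where "q = (1 - cmod (\<phi> 0)) / (1 + cmod (\<phi> 0))"
  \<comment> \<open>The maximum with 1 only serves to make the bound on \<open>\<psi>\<close> positive.\<close>
  define D where "D = (max M 1)\<^sup>2 * q powr (- s)"
  have self': "\<phi> z \<in> unit_disk" if "z \<in> unit_disk" for z
    using self that by blast
  have q: "0 < q"
    using self'[of 0] by (auto simp: q_def intro!: divide_pos_pos add_pos_nonneg)
  have D: "0 \<le> D" by (simp add: D_def)
  have B: "0 \<le> B"
    using order_trans[OF norm_ge_zero kernel[of 0]] by simp
  have main: "weighted_comp \<psi> \<phi> f \<in> weighted_hardy \<beta> \<and>
      wh_norm \<beta> (weighted_comp \<psi> \<phi> f) \<le> sqrt D * wh_norm \<beta> f" if f: "f \<in> weighted_hardy \<beta>" for f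
  proof -
    define F where "F z = \<psi> z * f (\<phi> z)" for z
    have f': "f holomorphic_on unit_disk" "square_summable (coord f)"
      using f by (auto simp: weighted_hardy_iff)
    have "(f \<circ> \<phi>) holomorphic_on unit_disk"
      using hol(2) f'(1) self by (rule holomorphic_on_compose_gen)
    then have F: "F holomorphic_on unit_disk"
      unfolding F_def using hol(1) by (auto intro!: holomorphic_intros simp: o_def)
    \<comment> \<open>Evaluating \<open>F\<close> against kernels at the \<open>w j\<close> is pairing \<open>f\<close> with the image \<open>v\<close> of their
      combination.\<close>
    have bound: "(cmod (\<Sum>j<m. cnj (c j) * F (w j)))\<^sup>2
        \<le> D * l2_normsq (coord f) * l2_normsq (\<lambda>n. \<Sum>j<m. c j * kernel_coord (w j) n)"
      if w: "\<And>j. j < m \<Longrightarrow> w j \<in> unit_disk" for m :: nat and c w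
    proof -
      define v where "v n = (\<Sum>j<m. (c j * cnj (\<psi> (w j))) * kernel_coord (\<phi> (w j)) n)" for n
      have v2: "square_summable v"
        unfolding v_def using w self'
        by (intro square_summable_sum square_summable_kernel_coord) auto
      have "l2_inner (coord f) v
          = (\<Sum>j<m. cnj (c j * cnj (\<psi> (w j))) * l2_inner (coord f) (kernel_coord (\<phi> (w j))))"
        unfolding v_def[abs_def] using w self' f'
        by (intro l2_inner_sum_right square_summable_kernel_coord) auto
      also have "\<dots> = (\<Sum>j<m. cnj (c j) * F (w j))"
        using w self' f' by (intro sum.cong refl) (simp add: l2_inner_kernel_coord F_def)
      finally have "(cmod (\<Sum>j<m. cnj (c j) * F (w j)))\<^sup>2 \<le> l2_normsq (coord f) * l2_normsq v"
        using l2_Cauchy_Schwarz[OF f'(2) v2] by simp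
      also have "\<dots> \<le> l2_normsq (coord f) * (D * l2_normsq (\<lambda>n. \<Sum>j<m. c j * kernel_coord (w j) n))"
      proof (rule mult_left_mono)
        show "l2_normsq v \<le> D * l2_normsq (\<lambda>n. \<Sum>j<m. c j * kernel_coord (w j) n)"
          unfolding v_def[abs_def] D_def
        proof (rule kernel_span_bound[OF self' symmetric _ _ _ q kernel s B w])
          show "cmod (\<psi> z) \<le> max M 1" if "z \<in> unit_disk" for z
            using psi[OF that] by simp
          show "q * (1 - (cmod z)\<^sup>2) \<le> 1 - (cmod (\<phi> z))\<^sup>2" if "z \<in> unit_disk" for z
            unfolding q_def using hol(2) self that by (rule selfmap_defect_lower_bound)
        qed auto
        show "0 \<le> l2_normsq (coord f)" using f'(2) by (rule l2_normsq_nonneg)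
      qed
      finally show ?thesis by (simp add: mult_ac)
    qed
    have B': "0 \<le> D * l2_normsq (coord f)"
      using D f'(2) by (simp add: l2_normsq_nonneg)
    note F2 = coord_bounded_by_point_evaluations[OF F B' bound]
    have W: "weighted_comp \<psi> \<phi> f = on_disk F" by (simp add: weighted_comp_def F_def[abs_def])
    have cW: "coord (on_disk F) = coord F"
      by (simp add: coord_def fun_eq_iff taylor_coeff_on_disk F)
    have "on_disk F \<in> weighted_hardy \<beta>"
      using holomorphic_on_disk[OF F] F2(1) by (simp add: weighted_hardy_iff cW) (simp add: on_disk_def)
    moreover have "sqrt (l2_normsq (coord F)) \<le> sqrt D * sqrt (l2_normsq (coord f))"
      unfolding real_sqrt_mult[symmetric] using F2(2) by (rule real_sqrt_le_mono)
    ultimately show ?thesis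
      using f by (simp add: W wh_norm_eq cW)
  qed
  then show ?thesis unfolding wh_bounded_def by blast
qed

lemma wh_hermitian_if_symmetric:
  assumes bounded: "wh_bounded \<beta> (weighted_comp \<psi> \<phi>)"
    and self: "\<phi> ` unit_disk \<subseteq> unit_disk"
    and symmetric: "\<And>z w. z \<in> unit_disk \<Longrightarrow> w \<in> unit_disk \<Longrightarrow>
      \<psi> z * generating_fun \<beta> (cnj w * \<phi> z) = cnj (\<psi> w) * generating_fun \<beta> (cnj (\<phi> w) * z)"
  shows "wh_hermitian \<beta> (weighted_comp \<psi> \<phi>)"
  unfolding wh_hermitian_def
proof
  let ?W = "weighted_comp \<psi> \<phi>"
  fix f assume f: "f \<in> weighted_hardy \<beta>"
  define h where "h = wh_adjoint \<beta> ?W f"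
  have h: "h \<in> weighted_hardy \<beta>"
    "\<And>g. g \<in> weighted_hardy \<beta> \<Longrightarrow> wh_inner \<beta> (?W g) f = wh_inner \<beta> g h"
    unfolding h_def using wh_adjoint_weighted_comp[OF bounded f] by auto
  have self': "\<phi> z \<in> unit_disk" if "z \<in> unit_disk" for z
    using self that by blast
  have "h = ?W f"
  proof (rule hardy_eqI[OF h(1)])
    show "?W f \<in> weighted_hardy \<beta>" using bounded f by (auto simp: wh_bounded_def)
    fix w :: complex assume w: "w \<in> unit_disk"
    have WK: "?W (kernel_fun w) = (\<lambda>z. cnj (\<psi> w) * kernel_fun (\<phi> w) z)"
      using symmetric[OF _ w] self' by (auto simp: weighted_comp_def on_disk_def kernel_fun_def)
    \<comment> \<open>The value \<open>h w\<close> is read off by testing the adjoint on the kernel at \<open>w\<close>.\<close>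
    have "cnj (h w) = wh_inner \<beta> (kernel_fun w) h"
      using wh_inner_commute[OF h(1) kernel_fun_in_hardy[OF w]] h(1) w
      by (simp add: wh_inner_kernel_fun)
    also have "\<dots> = cnj (\<psi> w) * wh_inner \<beta> (kernel_fun (\<phi> w)) f"
      using h(2)[OF kernel_fun_in_hardy[OF w]] f kernel_fun_in_hardy[OF self'[OF w]]
      by (simp add: WK wh_inner_scale_left)
    also have "\<dots> = cnj (\<psi> w * f (\<phi> w))"
      using wh_inner_commute[OF f kernel_fun_in_hardy[OF self'[OF w]]] f self'[OF w]
      by (simp add: wh_inner_kernel_fun)
    finally show "h w = ?W f w"
      using w by (simp add: weighted_comp_def on_disk_apply complex_cnj_cancel_iff del: complex_cnj_mult)
  qed
  then show "wh_adjoint \<beta> ?W f = ?W f" by (simp add: h_def)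
qed

end

section \<open>Exponential and binomial kernels\<close>

text \<open>The solution of \<open>k' * (1 - l * z) = \<kappa> * k\<close> with \<open>k 0 = 1\<close>; treating the exponential as
  the case \<open>l = 0\<close> gives both forms of the generating function a common description.\<close>

definition binomial_kernel :: "real \<Rightarrow> real \<Rightarrow> complex \<Rightarrow> complex" where
  "binomial_kernel \<kappa> l z =
     (if l = 0 then exp (complex_of_real \<kappa> * z)
      else (1 - complex_of_real l * z) powr complex_of_real (- (\<kappa> / l)))"

lemma one_minus_scaled_disk:
  fixes l :: real
  assumes "0 \<le> l" "l \<le> 1" "z \<in> unit_disk"
  shows "0 < Re (1 - complex_of_real l * z)" "1 - complex_of_real l * z \<noteq> 0"
    "1 - cmod z \<le> cmod (1 - complex_of_real l * z)"
    "1 - complex_of_real l * z \<notin> \<real>\<^sub>\<le>\<^sub>0"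
proof -
  have le: "cmod (complex_of_real l * z) \<le> cmod z"
    using mult_right_mono[OF assms(2), of "cmod z"] assms by (simp add: norm_mult)
  then have "Re (complex_of_real l * z) < 1"
    using complex_Re_le_cmod[of "complex_of_real l * z"] assms(3) by simp
  then show pos: "0 < Re (1 - complex_of_real l * z)" by simp
  then show "1 - complex_of_real l * z \<noteq> 0" by force
  show "1 - complex_of_real l * z \<notin> \<real>\<^sub>\<le>\<^sub>0"
    using pos by (simp add: complex_nonpos_Reals_iff)
  show "1 - cmod z \<le> cmod (1 - complex_of_real l * z)"
    using norm_triangle_ineq2[of 1 "complex_of_real l * z"] le by simp
qed

text \<open>The arguments of both factors are below \<open>pi / 2\<close> in absolute value, so their sum does not
  reach the branch cut.\<close>

lemma powr_mult_right_half_plane: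
  assumes "0 < Re x" "0 < Re y"
  shows "(x * y) powr p = x powr p * y powr p"
proof -
  have nz: "x \<noteq> 0" "y \<noteq> 0" using assms by auto
  then have "\<bar>Im (Ln x)\<bar> < pi / 2" "\<bar>Im (Ln y)\<bar> < pi / 2"
    using assms nz Re_Ln_pos_lt by blast+
  then have "- pi < Im (Ln x) + Im (Ln y)" "Im (Ln x) + Im (Ln y) \<le> pi"
    by (simp_all add: abs_less_iff)
  then show ?thesis
    using nz by (simp add: powr_def Ln_times_simple ring_distribs exp_add)
qed

lemma binomial_kernel_nonzero:
  assumes "0 \<le> l" "l \<le> 1" "z \<in> unit_disk"
  shows "binomial_kernel \<kappa> l z \<noteq> 0"
  using one_minus_scaled_disk(2)[OF assms] by (simp add: binomial_kernel_def)

lemma binomial_kernel_has_derivative: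
  assumes "0 \<le> l" "l \<le> 1" "z \<in> unit_disk"
  shows "(binomial_kernel \<kappa> l has_field_derivative
     complex_of_real \<kappa> / (1 - complex_of_real l * z) * binomial_kernel \<kappa> l z) (at z)"
proof (cases "l = 0")
  case True
  have "((\<lambda>z. exp (complex_of_real \<kappa> * z)) has_field_derivative
      complex_of_real \<kappa> * exp (complex_of_real \<kappa> * z)) (at z)"
    by (auto intro!: derivative_eq_intros)
  then show ?thesis using True by (simp add: binomial_kernel_def[abs_def])
next
  case False
  let ?x = "1 - complex_of_real l * z" and ?p = "complex_of_real (- (\<kappa> / l))"
  have x: "?x \<notin> \<real>\<^sub>\<le>\<^sub>0" "?x \<noteq> 0"
    using one_minus_scaled_disk[OF assms] by auto
  have "((\<lambda>z. (1 - complex_of_real l * z) powr ?p) has_field_derivative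
      (?p * ?x powr (?p - 1)) * (- complex_of_real l)) (at z)"
    by (rule DERIV_chain2[where f = "\<lambda>x. x powr ?p" and g = "\<lambda>z. 1 - complex_of_real l * z"])
       (auto intro!: derivative_eq_intros has_field_derivative_powr x(1))
  moreover have "(?p * ?x powr (?p - 1)) * (- complex_of_real l)
      = complex_of_real \<kappa> / ?x * ?x powr ?p"
    using False x by (simp add: powr_diff)
  ultimately show ?thesis using False by (simp add: binomial_kernel_def[abs_def])
qed

text \<open>For \<open>l = 0\<close> the exponent \<open>\<kappa> / l\<close> has the value 0, which is right since the exponential is
  bounded on the disk.\<close>

lemma binomial_kernel_growth:
  assumes "0 \<le> l" "l \<le> 1" "0 \<le> \<kappa>" "z \<in> unit_disk"
  shows "cmod (binomial_kernel \<kappa> l z) \<le> exp \<kappa> * (1 - cmod z) powr (- (\<kappa> / l))"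
proof (cases "l = 0")
  case True
  have "\<kappa> * Re z \<le> \<kappa> * 1"
    using assms complex_Re_le_cmod[of z] by (intro mult_left_mono) auto
  then show ?thesis using True assms by (simp add: binomial_kernel_def)
next
  case False
  have "cmod (binomial_kernel \<kappa> l z) = cmod (1 - complex_of_real l * z) powr (- (\<kappa> / l))"
    using False by (simp add: binomial_kernel_def norm_powr_real_powr')
  also have "\<dots> \<le> (1 - cmod z) powr (- (\<kappa> / l))"
    using one_minus_scaled_disk[OF assms(1,2,4)] assms by (intro powr_mono2') auto
  also have "\<dots> \<le> exp \<kappa> * (1 - cmod z) powr (- (\<kappa> / l))"
    using assms by (simp add: mult_le_cancel_right1)
  finally show ?thesis .
qed

text \<open>The hypothesis \<open>eq\<close> is the equality of the products \<open>(1 - l * u) * (1 - l * v)\<close> divided by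
  \<open>l\<close>; in this form it also covers \<open>l = 0\<close>, where it becomes equality of sums.\<close>

lemma binomial_kernel_mult_eq:
  assumes "0 \<le> l" "l \<le> 1" "u \<in> unit_disk" "v \<in> unit_disk" "u' \<in> unit_disk" "v' \<in> unit_disk"
    and eq: "u + v * (1 - complex_of_real l * u) = u' + v' * (1 - complex_of_real l * u')"
  shows "binomial_kernel \<kappa> l u * binomial_kernel \<kappa> l v
       = binomial_kernel \<kappa> l u' * binomial_kernel \<kappa> l v'"
proof (cases "l = 0")
  case True
  then have "u + v = u' + v'" using eq by simp
  then show ?thesis
    using True by (simp add: binomial_kernel_def exp_add[symmetric] ring_distribs[symmetric])
next
  case False
  have "(1 - complex_of_real l * u) * (1 - complex_of_real l * v)
      = 1 - complex_of_real l * (u + v * (1 - complex_of_real l * u))"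
    by (simp add: algebra_simps)
  also have "\<dots> = (1 - complex_of_real l * u') * (1 - complex_of_real l * v')"
    unfolding eq by (simp add: algebra_simps)
  finally show ?thesis
    using False one_minus_scaled_disk(1)[OF assms(1,2)] assms(3-6)
    by (simp add: binomial_kernel_def powr_mult_right_half_plane[symmetric])
qed

context weighted_hardy_space begin

text \<open>The logarithmic derivative of the kernel is \<open>\<kappa> / (1 - l * z)\<close>, so \<open>\<phi>\<close> is a
  linear fractional map, and both sides of the symmetry condition are values of one power (or
  exponential) at an expression that is symmetric under exchanging \<open>z\<close> with \<open>cnj w\<close> and conjugating
  the symbols.\<close>

lemma bounded_hermitian_of_binomial_kernel:
  fixes l :: real and \<psi> \<phi> :: "complex \<Rightarrow> complex" and a1 c :: complex
  defines "a0 \<equiv> \<phi> 0" and "k \<equiv> generating_fun \<beta>"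
  assumes \<psi>: "\<psi> holomorphic_on unit_disk" and \<phi>: "\<phi> holomorphic_on unit_disk"
    and self: "\<phi> ` unit_disk \<subseteq> unit_disk"
    and l: "0 \<le> l" "l \<le> 1"
    and k: "\<And>z. z \<in> unit_disk \<Longrightarrow> k z = binomial_kernel (1 / (\<beta> 1)\<^sup>2) l z"
    and real: "a1 \<in> \<real>" "c \<in> \<real>"
    and \<psi>_eq: "\<And>z. z \<in> unit_disk \<Longrightarrow> \<psi> z = c * k (cnj a0 * z)"
    and \<phi>_eq: "\<And>z. z \<in> unit_disk \<Longrightarrow> \<phi> z =
      a0 + a1 * complex_of_real ((\<beta> 1)\<^sup>2) * z * (deriv k (cnj a0 * z) / k (cnj a0 * z))"
  shows "wh_bounded \<beta> (weighted_comp \<psi> \<phi>)" "wh_hermitian \<beta> (weighted_comp \<psi> \<phi>)"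
proof -
  define \<kappa> where "\<kappa> = 1 / (\<beta> 1)\<^sup>2"
  have \<kappa>: "0 < \<kappa>" using beta_pos by (simp add: \<kappa>_def)
  have self': "\<phi> z \<in> unit_disk" if "z \<in> unit_disk" for z
    using self that by blast
  have a0: "a0 \<in> unit_disk" unfolding a0_def by (rule self') simp
  have cnj_real: "cnj a1 = a1" "cnj c = c"
    using real by (simp_all only: Reals_cnj_iff)
  have log_deriv: "deriv k u / k u = complex_of_real \<kappa> / (1 - complex_of_real l * u)"
    if u: "u \<in> unit_disk" for u
  proof -
    have "deriv k u = complex_of_real \<kappa> / (1 - complex_of_real l * u) * binomial_kernel \<kappa> l u"
    proof (rule DERIV_imp_deriv, rule has_field_derivative_transform_within_open[where S = unit_disk])
      show "(binomial_kernel \<kappa> l has_field_derivative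
          complex_of_real \<kappa> / (1 - complex_of_real l * u) * binomial_kernel \<kappa> l u) (at u)"
        by (rule binomial_kernel_has_derivative[OF l u])
    qed (use u k in \<open>auto simp: \<kappa>_def\<close>)
    then show ?thesis
      using k[OF u] binomial_kernel_nonzero[OF l u, of \<kappa>] by (simp add: \<kappa>_def)
  qed
  have \<phi>_moebius: "\<phi> z = a0 + a1 * z / (1 - complex_of_real l * (cnj a0 * z))" if z: "z \<in> unit_disk" for z
    using \<phi>_eq[OF z] log_deriv[OF mult_unit_disk[OF z a0]] by (simp add: \<kappa>_def)
  have symmetric: "\<psi> z * k (cnj w * \<phi> z) = cnj (\<psi> w) * k (cnj (\<phi> w) * z)"
    if z: "z \<in> unit_disk" and w: "w \<in> unit_disk" for z w
  proof -
    let ?l = "complex_of_real l"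
    let ?u = "cnj a0 * z" and ?v = "cnj w * \<phi> z" and ?u' = "cnj w * a0" and ?v' = "cnj (\<phi> w) * z"
    have disks: "?u \<in> unit_disk" "?v \<in> unit_disk" "?u' \<in> unit_disk" "?v' \<in> unit_disk"
      by (intro mult_unit_disk self' z w a0)+
    have nz: "1 - ?l * ?u \<noteq> 0" "1 - ?l * ?u' \<noteq> 0"
      using one_minus_scaled_disk(2)[OF l] disks by auto
    have "\<phi> z * (1 - ?l * ?u) = a0 * (1 - ?l * ?u) + a1 * z"
      using \<phi>_moebius[OF z] nz by (simp add: field_simps)
    then have 1: "?u + ?v * (1 - ?l * ?u) = ?u + cnj w * (a0 * (1 - ?l * ?u) + a1 * z)"
      by (simp add: mult.assoc)
    have "cnj (\<phi> w) = cnj a0 + a1 * cnj w / (1 - ?l * ?u')"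
      unfolding \<phi>_moebius[OF w] by (simp add: cnj_real mult.commute)
    then have "cnj (\<phi> w) * (1 - ?l * ?u') = cnj a0 * (1 - ?l * ?u') + a1 * cnj w"
      using nz by (simp add: field_simps)
    then have 2: "?u' + ?v' * (1 - ?l * ?u') = ?u' + z * (cnj a0 * (1 - ?l * ?u') + a1 * cnj w)"
      by (simp add: mult_ac)
    have "k ?u * k ?v = k ?u' * k ?v'"
      unfolding disks[THEN k]
      by (rule binomial_kernel_mult_eq[OF l disks]) (unfold 1 2, simp add: algebra_simps)
    moreover have "cnj (\<psi> w) = c * k ?u'"
      using generating_fun_cnj[OF mult_unit_disk[OF w a0]] \<psi>_eq[OF w]
      by (simp add: k_def cnj_real mult.commute)
    ultimately show ?thesis
      by (simp add: \<psi>_eq[OF z] mult.assoc)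
  qed
  have growth: "cmod (k u) \<le> exp \<kappa> * (1 - cmod u) powr (- (\<kappa> / l))" if "u \<in> unit_disk" for u
    using binomial_kernel_growth[OF l _ that, of \<kappa>] k[OF that] \<kappa> by (simp add: \<kappa>_def)
  have s: "0 \<le> \<kappa> / l" using \<kappa> l by simp
  have psi_bound: "cmod (\<psi> z) \<le> cmod c * (exp \<kappa> * (1 - cmod a0) powr (- (\<kappa> / l)))"
    if z: "z \<in> unit_disk" for z
  proof -
    have "cmod (cnj a0 * z) \<le> cmod a0 * 1"
      unfolding norm_mult complex_mod_cnj using z by (intro mult_left_mono) auto
    then have "(1 - cmod (cnj a0 * z)) powr (- (\<kappa> / l)) \<le> (1 - cmod a0) powr (- (\<kappa> / l))"
      using s a0 by (intro powr_mono2') auto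
    then have "cmod (k (cnj a0 * z)) \<le> exp \<kappa> * (1 - cmod a0) powr (- (\<kappa> / l))"
      using growth[OF mult_unit_disk[OF z a0]]
      by (meson exp_ge_zero mult_left_mono order_trans)
    then show ?thesis
      unfolding \<psi>_eq[OF z] norm_mult by (rule mult_left_mono) simp
  qed
  show bounded: "wh_bounded \<beta> (weighted_comp \<psi> \<phi>)"
    by (rule wh_bounded_if_symmetric[OF \<psi> \<phi> self symmetric[unfolded k_def] psi_bound
          growth[unfolded k_def] s])
  show "wh_hermitian \<beta> (weighted_comp \<psi> \<phi>)"
    by (rule wh_hermitian_if_symmetric[OF bounded self symmetric[unfolded k_def]])
qed

end

section \<open>The differential equation of the kernel\<close>

text \<open>A first integral. It is valid where \<open>deriv f\<close> has no zero, in particular near 0, and extends to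
  the disk by the identity theorem because it no longer contains a division.\<close>

lemma quadratic_ODE_linearize:
  assumes hol: "f holomorphic_on unit_disk"
    and init: "f 0 = 1" "deriv f 0 \<noteq> 0"
    and r: "0 < r" "r \<le> 1"
    and ode: "\<And>z. z \<in> ball 0 r \<Longrightarrow> f z * deriv (deriv f) z = \<mu> * (deriv f z)\<^sup>2"
    and z: "z \<in> unit_disk"
  shows "deriv f z * (1 - (\<mu> - 1) * deriv f 0 * z) = deriv f 0 * f z"
proof -
  have hol': "deriv f holomorphic_on unit_disk"
    using hol by (rule holomorphic_deriv) simp
  have "continuous (at 0) (deriv f)"
    using holomorphic_on_imp_continuous_on[OF hol'] by (simp add: continuous_on_eq_continuous_at)
  from continuous_at_avoid[OF this init(2)]
  obtain e where e: "0 < e" "\<And>z. cmod z < e \<Longrightarrow> deriv f z \<noteq> 0" by auto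
  define \<rho> where "\<rho> = min e r"
  have \<rho>: "0 < \<rho>" "ball 0 \<rho> \<subseteq> (unit_disk :: complex set)"
    using e r by (auto simp: \<rho>_def)
  \<comment> \<open>Near 0 the equation says that the derivative of \<open>f / f'\<close> is the constant \<open>1 - \<mu>\<close>.\<close>
  have "(\<lambda>z. f z / deriv f z - (1 - \<mu>) * z) constant_on ball 0 \<rho>"
  proof (rule has_field_derivative_0_imp_constant_on)
    fix z :: complex assume z: "z \<in> ball 0 \<rho>"
    then have zd: "z \<in> unit_disk" and nz: "deriv f z \<noteq> 0"
      and eq: "f z * deriv (deriv f) z = \<mu> * (deriv f z)\<^sup>2"
      using \<rho> e(2) ode by (auto simp: \<rho>_def)
    have "((\<lambda>z. f z / deriv f z - (1 - \<mu>) * z) has_field_derivative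
        (deriv f z * deriv f z - f z * deriv (deriv f) z) / (deriv f z * deriv f z) - (1 - \<mu>)) (at z)"
      using holomorphic_derivI[OF hol _ zd] holomorphic_derivI[OF hol' _ zd] nz
      by (auto intro!: derivative_eq_intros)
    then show "((\<lambda>z. f z / deriv f z - (1 - \<mu>) * z) has_field_derivative 0) (at z)"
      unfolding eq using nz by (simp add: field_simps power2_eq_square)
  qed auto
  then obtain C where C: "\<And>z. z \<in> ball 0 \<rho> \<Longrightarrow> f z / deriv f z - (1 - \<mu>) * z = C"
    by (auto simp: constant_on_def)
  have C0: "C = 1 / deriv f 0" using C[of 0] \<rho> init by simp
  show ?thesis
  proof (rule analytic_continuation_open[of "ball 0 \<rho>" unit_disk, OF _ _ _ _ \<rho>(2) _ _ _ z])
    fix z :: complex assume "z \<in> ball 0 \<rho>"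
    then have "f z / deriv f z - (1 - \<mu>) * z = 1 / deriv f 0" "deriv f z \<noteq> 0"
      using C C0 e(2) by (auto simp: \<rho>_def)
    then show "deriv f z * (1 - (\<mu> - 1) * deriv f 0 * z) = deriv f 0 * f z"
      using init(2) by (simp add: field_simps)
  qed (use \<rho> in \<open>auto intro!: holomorphic_intros hol hol'\<close>)
qed

lemma linear_ODE_solution:
  assumes hol: "f holomorphic_on unit_disk" and init: "f 0 = 1" and l: "0 \<le> l" "l \<le> 1"
    and ode: "\<And>z. z \<in> unit_disk \<Longrightarrow>
       deriv f z * (1 - complex_of_real l * z) = complex_of_real \<kappa> * f z"
    and z: "z \<in> unit_disk"
  shows "f z = binomial_kernel \<kappa> l z"
proof -
  let ?G = "binomial_kernel \<kappa> l"
  have "(\<lambda>z. f z / ?G z) constant_on unit_disk"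
  proof (rule has_field_derivative_0_imp_constant_on)
    fix z :: complex assume z: "z \<in> unit_disk"
    note x = one_minus_scaled_disk(2)[OF l z]
    have f': "deriv f z = complex_of_real \<kappa> * f z / (1 - complex_of_real l * z)"
      using ode[OF z] x by (simp add: field_simps)
    have "((\<lambda>z. f z / ?G z) has_field_derivative
        (deriv f z * ?G z - f z * (complex_of_real \<kappa> / (1 - complex_of_real l * z) * ?G z))
          / (?G z * ?G z)) (at z)"
      using holomorphic_derivI[OF hol _ z] binomial_kernel_nonzero[OF l z]
      by (intro DERIV_divide binomial_kernel_has_derivative l z) auto
    then show "((\<lambda>z. f z / ?G z) has_field_derivative 0) (at z)"
      by (simp add: f')
  qed auto
  then obtain C where C: "\<And>z. z \<in> unit_disk \<Longrightarrow> f z / ?G z = C"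
    by (auto simp: constant_on_def)
  have "C = 1" using C[of 0] init by (cases "l = 0") (simp_all add: binomial_kernel_def)
  then show ?thesis using C[OF z] binomial_kernel_nonzero[OF l z] by simp
qed

context weighted_hardy_space begin

text \<open>The equation is a recursion for the coefficients, in which \<open>\<kappa> + l * (n + 1)\<close> is a
  quotient of positive numbers for every \<open>n\<close>. Hence \<open>l\<close> is not negative. Convergence on the whole disk
  excludes \<open>l > 1\<close>.\<close>

lemma linear_ODE_parameter_bounds:
  assumes ode: "\<And>z. z \<in> unit_disk \<Longrightarrow> deriv (generating_fun \<beta>) z * (1 - complex_of_real l * z)
      = complex_of_real \<kappa> * generating_fun \<beta> z"
  shows "0 \<le> l" "l \<le> 1"
proof -
  let ?k = "generating_fun \<beta>"
  have hol': "deriv ?k holomorphic_on unit_disk"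
    using generating_fun_holomorphic by (rule holomorphic_deriv) simp
  have rec: "\<kappa> / (\<beta> (Suc n))\<^sup>2 + l * (real (Suc n) / (\<beta> (Suc n))\<^sup>2)
      = real (Suc (Suc n)) / (\<beta> (Suc (Suc n)))\<^sup>2" for n
  proof -
    let ?g = "\<lambda>z. complex_of_real \<kappa> * ?k z + complex_of_real l * (z * deriv ?k z)"
    have "taylor_coeff (deriv ?k) (Suc n)
        = complex_of_real \<kappa> * taylor_coeff ?k (Suc n) + complex_of_real l * taylor_coeff (deriv ?k) n"
    proof -
      have "taylor_coeff (deriv ?k) (Suc n) = complex_of_real \<kappa> * taylor_coeff ?k (Suc n)
          + complex_of_real l * taylor_coeff (\<lambda>z. z * deriv ?k z) (Suc n)"
      proof (rule taylor_coeff_eqI[where n = "Suc n" and a = "\<lambda>n. complex_of_real \<kappa> * taylor_coeff ?k n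
          + complex_of_real l * taylor_coeff (\<lambda>z. z * deriv ?k z) n"])
        fix z :: complex assume z: "z \<in> unit_disk"
        have "(\<lambda>n. complex_of_real \<kappa> * (taylor_coeff ?k n * z ^ n)
            + complex_of_real l * (taylor_coeff (\<lambda>z. z * deriv ?k z) n * z ^ n)) sums ?g z"
          by (intro sums_add sums_mult taylor_coeff_sums[of "\<lambda>z. z * deriv ?k z"] z
               taylor_coeff_sums[of ?k] generating_fun_holomorphic holomorphic_intros hol')
        moreover have "?g z = deriv ?k z"
          using ode[OF z] by (simp add: algebra_simps)
        ultimately show "(\<lambda>n. (complex_of_real \<kappa> * taylor_coeff ?k n
            + complex_of_real l * taylor_coeff (\<lambda>z. z * deriv ?k z) n) * z ^ n) sums deriv ?k z"
          by (simp add: algebra_simps)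
      qed
      then show ?thesis by (simp add: taylor_coeff_times_z hol')
    qed
    then have "complex_of_real (real (Suc (Suc n)) * (1 / (\<beta> (Suc (Suc n)))\<^sup>2))
       = complex_of_real (\<kappa> * (1 / (\<beta> (Suc n))\<^sup>2) + l * (real (Suc n) * (1 / (\<beta> (Suc n))\<^sup>2)))"
      unfolding taylor_coeff_deriv taylor_coeff_generating_fun
      by (simp only: of_real_mult of_real_add of_real_of_nat_eq)
    then show ?thesis unfolding of_real_eq_iff by (simp only: times_divide_eq_right mult_1_right)
  qed
  show "0 \<le> l"
  proof (rule ccontr)
    assume "\<not> 0 \<le> l"
    then obtain n where n: "\<kappa> < real n * (- l)"
      using reals_Archimedean3[of "- l"] by auto
    then have n': "\<kappa> + l * real (Suc n) \<le> 0" using \<open>\<not> 0 \<le> l\<close> by (simp add: algebra_simps)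
    have "0 < real (Suc (Suc n)) / (\<beta> (Suc (Suc n)))\<^sup>2"
      using beta_pos by simp
    also have "\<dots> = (\<kappa> + l * real (Suc n)) / (\<beta> (Suc n))\<^sup>2"
      unfolding rec[symmetric] by (simp only: add_divide_distrib times_divide_eq_right)
    also have "\<dots> \<le> 0" using n' by (intro divide_nonpos_nonneg) auto
    finally show False by simp
  qed
  show "l \<le> 1"
  proof (rule ccontr)
    assume "\<not> l \<le> 1"
    \<comment> \<open>At \<open>1 / l\<close> the equation forces a zero, but a series with positive coefficients has none
      on the positive axis.\<close>
    define x where "x = 1 / l"
    have x: "0 < x" "x < 1" "l * x = 1" using \<open>\<not> l \<le> 1\<close> by (auto simp: x_def)
    then have xd: "complex_of_real x \<in> unit_disk" by simp
    have "complex_of_real \<kappa> * ?k x = 0"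
      using ode[OF xd] x by (simp flip: of_real_mult)
    moreover have "\<kappa> = 1 / (\<beta> 1)\<^sup>2"
      using ode[of 0] by (simp add: generating_fun_0 deriv_generating_fun_0)
        (metis of_real_divide of_real_eq_iff of_real_power of_real_1)
    ultimately have "?k x = 0" by simp
    moreover have "(\<lambda>n. 1 / (\<beta> n)\<^sup>2 * x ^ n) sums Re (?k x)"
      using sums_Re[OF generating_fun_sums[OF xd]] by (simp flip: of_real_power)
    moreover from this have "0 < (\<Sum>n. 1 / (\<beta> n)\<^sup>2 * x ^ n)"
      using x beta_pos by (intro suminf_pos) (auto simp: sums_iff)
    ultimately show False by (simp add: sums_iff)
  qed
qed

end

section \<open>Consequences of the adjoint identities for quadratic polynomials\<close>

lemma quadratic_ODE_algebra:
  fixes K K' K'' a b w p q :: complex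
  assumes "(a * K + b / p * (w * K'))\<^sup>2 * q
      = K * (w\<^sup>2 * K'' * b\<^sup>2 / 2 + w * K' * (b * a * (2 * q / p - p)) + a * p * (w * K' * b) + a\<^sup>2 * q * K)"
    and "p \<noteq> 0"
  shows "(w * b)\<^sup>2 * (K * K'') = (w * b)\<^sup>2 * (2 * q / p\<^sup>2 * K'\<^sup>2)"
proof -
  \<comment> \<open>Substituting \<open>b = d * p\<close> makes the equation polynomial.\<close>
  define d where "d = b / p"
  have b: "b = d * p" using assms(2) by (simp add: d_def)
  have "b * a * (2 * q / p - p) = d * a * (2 * q - p\<^sup>2)"
    using assms(2) by (simp add: b field_simps power2_eq_square)
  with assms(1) have "(a * K + d * (w * K'))\<^sup>2 * q
      = K * (w\<^sup>2 * K'' * (d * p)\<^sup>2 / 2 + w * K' * (d * a * (2 * q - p\<^sup>2)) + a * p * (w * K' * (d * p)) + a\<^sup>2 * q * K)"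
    by (simp only: d_def[symmetric] b[symmetric])
  then have "(w * (d * p))\<^sup>2 * (K * K'') = 2 * (w * d)\<^sup>2 * q * K'\<^sup>2"
    by (auto simp add: power2_eq_square algebra_simps)
  moreover have "(w * b)\<^sup>2 * (2 * q / p\<^sup>2 * K'\<^sup>2) = 2 * (w * d)\<^sup>2 * q * K'\<^sup>2"
    using assms(2) by (simp add: b power_mult_distrib)
  ultimately show ?thesis by (simp add: b)
qed

context weighted_hardy_space begin

text \<open>Pairing with \<open>z ^ n\<close> extracts the \<open>n\<close>-th coefficient and pairing with a kernel evaluates. The
  condition on the adjoint at \<open>z ^ n\<close>, tested on the kernel at \<open>w\<close>, therefore becomes an identity
  between functions of \<open>w\<close>.\<close>

lemma adjoint_on_monomial:
  assumes bounded: "wh_bounded \<beta> (weighted_comp \<psi> \<phi>)"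
    and \<psi>: "\<psi> holomorphic_on unit_disk" and \<phi>: "\<phi> holomorphic_on unit_disk"
    and self: "\<phi> ` unit_disk \<subseteq> unit_disk"
    and eq: "wh_adjoint \<beta> (weighted_comp \<psi> \<phi>) (mono_fun n) = weighted_comp \<psi> \<phi> (mono_fun n)"
    and w: "w \<in> unit_disk"
  shows "cnj (\<psi> w * \<phi> w ^ n) = complex_of_real ((\<beta> n)\<^sup>2) *
     taylor_coeff (\<lambda>z. \<psi> z * generating_fun \<beta> (cnj w * \<phi> z)) n"
proof -
  let ?W = "weighted_comp \<psi> \<phi>"
  have self': "\<phi> z \<in> unit_disk" if "z \<in> unit_disk" for z
    using self that by blast
  have K: "kernel_fun w \<in> weighted_hardy \<beta>" using w by (rule kernel_fun_in_hardy)
  have Wn: "?W (mono_fun n) \<in> weighted_hardy \<beta>"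
    using bounded mono_fun_in_hardy by (auto simp: wh_bounded_def)
  let ?F = "\<lambda>z. \<psi> z * generating_fun \<beta> (cnj w * \<phi> z)"
  have "(\<lambda>z. generating_fun \<beta> (cnj w * \<phi> z)) holomorphic_on unit_disk"
    using holomorphic_on_compose_gen[OF \<phi> kernel_fun_holomorphic[OF w] self] by (simp add: o_def)
  then have F: "?F holomorphic_on unit_disk"
    by (intro holomorphic_intros \<psi>)
  have "cnj (\<psi> w * \<phi> w ^ n) = cnj (?W (mono_fun n) w)"
    using w self' by (simp add: weighted_comp_def on_disk_apply)
  also have "\<dots> = wh_inner \<beta> (kernel_fun w) (?W (mono_fun n))"
    using wh_inner_commute[OF Wn K] Wn w by (simp add: wh_inner_kernel_fun)
  also have "\<dots> = wh_inner \<beta> (?W (kernel_fun w)) (mono_fun n)"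
    using wh_adjoint_weighted_comp(2)[OF bounded mono_fun_in_hardy[of n] K] by (simp only: eq)
  also have "\<dots> = taylor_coeff (?W (kernel_fun w)) n * complex_of_real ((\<beta> n)\<^sup>2)"
    by (rule wh_inner_mono_fun)
  also have "taylor_coeff (?W (kernel_fun w)) n = taylor_coeff ?F n"
    by (rule taylor_coeff_cong[OF F])
       (use self' in \<open>simp add: weighted_comp_def on_disk_apply kernel_fun_def\<close>)
  finally show ?thesis by (simp add: mult.commute)
qed

end

text \<open>The second condition of the theorem, with the standing hypotheses on the symbols. The
  adjoint identities for \<open>n = 0, 1, 2\<close> determine \<open>\<psi>\<close>, then \<open>\<phi>\<close>, and then the generating function.\<close>

locale hermitian_on_quadratics = weighted_hardy_space +
  fixes \<psi> \<phi> :: "complex \<Rightarrow> complex"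
  assumes \<phi>: "\<phi> holomorphic_on unit_disk" and self: "\<phi> ` unit_disk \<subseteq> unit_disk"
    and \<phi>0: "\<phi> 0 \<noteq> 0" and \<phi>'0: "deriv \<phi> 0 \<noteq> 0"
    and \<psi>: "\<psi> holomorphic_on unit_disk" and \<psi>_nz: "\<exists>z\<in>unit_disk. \<psi> z \<noteq> 0"
    and bounded: "wh_bounded \<beta> (weighted_comp \<psi> \<phi>)"
    and adj: "n \<le> 2 \<Longrightarrow>
      wh_adjoint \<beta> (weighted_comp \<psi> \<phi>) (mono_fun n) = weighted_comp \<psi> \<phi> (mono_fun n)"
begin

abbreviation "k \<equiv> generating_fun \<beta>"

abbreviation "a0 \<equiv> \<phi> 0"

abbreviation "a1 \<equiv> deriv \<phi> 0"

abbreviation "c \<equiv> \<psi> 0"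

abbreviation "k1 \<equiv> complex_of_real (1 / (\<beta> 1)\<^sup>2)"

abbreviation "k2 \<equiv> complex_of_real (1 / (\<beta> 2)\<^sup>2)"

lemma self': "z \<in> unit_disk \<Longrightarrow> \<phi> z \<in> unit_disk"
  using self by blast

lemma a0_disk: "a0 \<in> unit_disk"
  by (rule self') simp

lemma k_hol: "k holomorphic_on unit_disk" "deriv k holomorphic_on unit_disk"
    "deriv (deriv k) holomorphic_on unit_disk"
  by (auto intro!: holomorphic_deriv generating_fun_holomorphic)

lemma cnj_k:
  assumes "z \<in> unit_disk"
  shows "cnj (k z) = k (cnj z)" "cnj (deriv k z) = deriv k (cnj z)"
    "cnj (deriv (deriv k) z) = deriv (deriv k) (cnj z)"
  by (rule cnj_of_real_taylor_coeffs[OF _ _ assms], (rule k_hol),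
      simp add: taylor_coeff_deriv taylor_coeff_generating_fun)+

lemma disk: "w \<in> unit_disk \<Longrightarrow> cnj w * a0 \<in> unit_disk" "w \<in> unit_disk \<Longrightarrow> cnj a0 * w \<in> unit_disk"
  using mult_unit_disk[OF a0_disk] mult_unit_disk[OF _ a0_disk] by blast+

lemma adjoint_identity:
  assumes "n \<le> 2" "w \<in> unit_disk"
  shows "cnj (\<psi> w * \<phi> w ^ n) = complex_of_real ((\<beta> n)\<^sup>2) *
     (\<Sum>i\<le>n. taylor_coeff \<psi> i * taylor_coeff (\<lambda>z. k (cnj w * \<phi> z)) (n - i))"
proof -
  have "(\<lambda>z. k (cnj w * \<phi> z)) holomorphic_on unit_disk"
    using holomorphic_on_compose_gen[OF \<phi> kernel_fun_holomorphic[OF assms(2)] self]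
    by (simp add: o_def)
  then show ?thesis
    using adjoint_on_monomial[OF bounded \<psi> \<phi> self adj[OF assms(1)] assms(2)]
    by (simp add: taylor_coeff_mult[OF \<psi>])
qed

lemma coeffs_k_phi:
  assumes w: "w \<in> unit_disk"
  shows "taylor_coeff (\<lambda>z. k (cnj w * \<phi> z)) 0 = k (cnj w * a0)"
    "taylor_coeff (\<lambda>z. k (cnj w * \<phi> z)) 1 = cnj w * deriv k (cnj w * a0) * a1"
    "taylor_coeff (\<lambda>z. k (cnj w * \<phi> z)) 2 = (cnj w)\<^sup>2 * deriv (deriv k) (cnj w * a0) * a1\<^sup>2 / 2
       + cnj w * deriv k (cnj w * a0) * taylor_coeff \<phi> 2"
  using taylor_coeff_compose[OF kernel_fun_holomorphic[OF w] \<phi> self]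
    deriv_dilation[OF k_hol(1) w a0_disk] by simp_all

text \<open>The identity for \<open>n = 0\<close>: \<open>\<psi>\<close> is a multiple of the kernel at \<open>\<phi> 0\<close>.\<close>

lemma c_real: "c \<in> \<real>"
  and psi_eq: "w \<in> unit_disk \<Longrightarrow> \<psi> w = c * k (cnj a0 * w)"
proof -
  have cnj_psi: "cnj (\<psi> w) = c * k (cnj w * a0)" if "w \<in> unit_disk" for w
  proof -
    have "cnj (\<psi> w * \<phi> w ^ 0) = complex_of_real ((\<beta> 0)\<^sup>2) *
       (\<Sum>i\<le>0. taylor_coeff \<psi> i * taylor_coeff (\<lambda>z. k (cnj w * \<phi> z)) (0 - i))"
      using that by (intro adjoint_identity) auto
    then show ?thesis
      using coeffs_k_phi(1)[OF that] taylor_coeff_simps(1)[OF \<psi>] by (simp add: beta_0)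
  qed
  have "cnj c = c" using cnj_psi[of 0] by (simp add: generating_fun_0)
  then show "c \<in> \<real>" by (simp only: Reals_cnj_iff)
  assume w: "w \<in> unit_disk"
  have "\<psi> w = cnj (cnj (\<psi> w))" by simp
  also have "\<dots> = cnj c * cnj (k (cnj w * a0))"
    unfolding cnj_psi[OF w] by (rule complex_cnj_mult)
  also have "\<dots> = c * k (cnj a0 * w)"
    unfolding cnj_k(1)[OF disk(1)[OF w]] \<open>cnj c = c\<close> by (simp only: complex_cnj_mult complex_cnj_cnj mult.commute)
  finally show "\<psi> w = c * k (cnj a0 * w)" .
qed

lemma c_nonzero: "c \<noteq> 0"
  using \<psi>_nz psi_eq by (metis mult_zero_left)

lemma psi_coeffs: "taylor_coeff \<psi> n = c * (cnj a0 ^ n * complex_of_real (1 / (\<beta> n)\<^sup>2))"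
proof -
  have "taylor_coeff \<psi> n = c * taylor_coeff (\<lambda>z. k (cnj a0 * z)) n"
  proof (rule taylor_coeff_eqI)
    fix z :: complex assume z: "z \<in> unit_disk"
    show "(\<lambda>n. c * taylor_coeff (\<lambda>z. k (cnj a0 * z)) n * z ^ n) sums \<psi> z"
      unfolding psi_eq[OF z] mult.assoc
      by (intro sums_mult taylor_coeff_sums dilate_holomorphic[where f = k] k_hol a0_disk z)
  qed
  then show ?thesis
    by (simp add: taylor_coeff_dilation[OF k_hol(1) a0_disk] taylor_coeff_generating_fun)
qed

lemma k1_nonzero: "k1 \<noteq> 0" "k2 \<noteq> 0"
  by simp_all

text \<open>The identity for \<open>n = 1\<close>. It is kept in product form because zeros of \<open>k\<close> are excluded only
  after the explicit form of \<open>k\<close> is known.\<close>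

lemma a1_real: "a1 \<in> \<real>"
  and phi_eq: "w \<in> unit_disk \<Longrightarrow>
    k (cnj a0 * w) * \<phi> w = a0 * k (cnj a0 * w) + a1 / k1 * (w * deriv k (cnj a0 * w))"
  and phi2: "taylor_coeff \<phi> 2 = a1 * cnj a0 * (2 * k2 / k1 - k1)"
proof -
  let ?u = "\<lambda>w. cnj a0 * w"
  have main: "k (?u w) * \<phi> w = a0 * k (?u w) + cnj a1 / k1 * (w * deriv k (?u w))"
    if w: "w \<in> unit_disk" for w
  proof -
    have "cnj (\<psi> w * \<phi> w) * k1 = c * cnj w * deriv k (cnj w * a0) * a1 + c * cnj a0 * k1 * k (cnj w * a0)"
      using adjoint_identity[of 1 w] w coeffs_k_phi(1,2)[OF w] psi_coeffs[of 0] psi_coeffs[of 1]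
      by (simp add: beta_0 mult_ac)
    then have "cnj (cnj (\<psi> w * \<phi> w) * k1)
       = cnj (c * cnj w * deriv k (cnj w * a0) * a1 + c * cnj a0 * k1 * k (cnj w * a0))"
      by simp
    then have "c * k (?u w) * \<phi> w * k1
        = c * w * deriv k (?u w) * cnj a1 + c * a0 * k1 * k (?u w)"
      using c_real[unfolded Reals_cnj_iff] cnj_k[OF disk(1)[OF w]] psi_eq[OF w]
      by (simp add: mult.commute)
    then have "c * (k (?u w) * \<phi> w * k1) = c * (w * deriv k (?u w) * cnj a1 + a0 * k1 * k (?u w))"
      by (simp add: algebra_simps)
    then have "k (?u w) * \<phi> w * k1 = w * deriv k (?u w) * cnj a1 + a0 * k1 * k (?u w)"
      by (rule iffD1[OF mult_left_cancel[OF c_nonzero]])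
    then show ?thesis using k1_nonzero(1) by (simp add: field_simps)
  qed
  have khol: "(\<lambda>w. k (?u w)) holomorphic_on unit_disk" "(\<lambda>w. deriv k (?u w)) holomorphic_on unit_disk"
    by (intro dilate_holomorphic k_hol a0_disk)+
  \<comment> \<open>Comparison of the coefficients of \<open>w ^ Suc n\<close>; the first gives that \<open>a1\<close> is real, the second
    gives the second coefficient of \<open>\<phi>\<close>.\<close>
  have coeffs: "(\<Sum>i\<le>Suc n. cnj a0 ^ i * complex_of_real (1 / (\<beta> i)\<^sup>2) * taylor_coeff \<phi> (Suc n - i))
      = a0 * (cnj a0 ^ Suc n * complex_of_real (1 / (\<beta> (Suc n))\<^sup>2))
        + cnj a1 / k1 * (cnj a0 ^ n * (of_nat (Suc n) * complex_of_real (1 / (\<beta> (Suc n))\<^sup>2)))" for n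
  proof -
    have "taylor_coeff (\<lambda>w. k (?u w) * \<phi> w) (Suc n)
      = a0 * taylor_coeff (\<lambda>w. k (?u w)) (Suc n)
        + cnj a1 / k1 * taylor_coeff (\<lambda>w. w * deriv k (?u w)) (Suc n)"
    proof (rule taylor_coeff_eqI[where n = "Suc n" and a = "\<lambda>n. a0 * taylor_coeff (\<lambda>w. k (?u w)) n
        + cnj a1 / k1 * taylor_coeff (\<lambda>w. w * deriv k (?u w)) n"])
      fix w :: complex assume w: "w \<in> unit_disk"
      have "(\<lambda>n. a0 * (taylor_coeff (\<lambda>w. k (?u w)) n * w ^ n)
        + cnj a1 / k1 * (taylor_coeff (\<lambda>w. w * deriv k (?u w)) n * w ^ n)) sums
          (a0 * k (?u w) + cnj a1 / k1 * (w * deriv k (?u w)))"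
        by (intro sums_add sums_mult taylor_coeff_sums[of "\<lambda>w. k (?u w)"]
              taylor_coeff_sums[of "\<lambda>w. w * deriv k (?u w)"] holomorphic_intros khol w)
      then show "(\<lambda>n. (a0 * taylor_coeff (\<lambda>w. k (?u w)) n
        + cnj a1 / k1 * taylor_coeff (\<lambda>w. w * deriv k (?u w)) n) * w ^ n) sums (k (?u w) * \<phi> w)"
        unfolding main[OF w] ring_distribs mult.assoc .
    qed
    then show ?thesis
      unfolding taylor_coeff_mult[OF khol(1) \<phi>] taylor_coeff_times_z[OF khol(2)]
        taylor_coeff_dilation[OF k_hol(1) a0_disk] taylor_coeff_dilation[OF k_hol(2) a0_disk]
        taylor_coeff_deriv taylor_coeff_generating_fun .
  qed
  have p01: "taylor_coeff \<phi> 0 = a0" "taylor_coeff \<phi> (Suc 0) = a1"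
    using taylor_coeff_simps[OF \<phi>] by simp_all
  have cnj_a1: "cnj a1 = a1"
    using coeffs[of 0] k1_nonzero(1) by (simp add: p01 beta_0 mult_ac)
  then show "a1 \<in> \<real>" by (simp only: Reals_cnj_iff)
  show "w \<in> unit_disk \<Longrightarrow> k (?u w) * \<phi> w = a0 * k (?u w) + a1 / k1 * (w * deriv k (?u w))"
    using main[of w] unfolding cnj_a1 .
  have "taylor_coeff \<phi> 2 + cnj a0 * k1 * a1 + (cnj a0)\<^sup>2 * k2 * a0
      = a0 * ((cnj a0)\<^sup>2 * k2) + a1 / k1 * (cnj a0 * (2 * k2))"
    using coeffs[of 1, unfolded cnj_a1] 
    by (simp add: p01 beta_0 numeral_2_eq_2 atMost_Suc add_ac)
  then have "taylor_coeff \<phi> 2 = a1 / k1 * (cnj a0 * (2 * k2)) - cnj a0 * k1 * a1"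
    by (simp add: algebra_simps)
  then show "taylor_coeff \<phi> 2 = a1 * cnj a0 * (2 * k2 / k1 - k1)"
    by (simp add: algebra_simps)
qed

text \<open>The identity for \<open>n = 2\<close>, with \<open>\<psi>\<close> and \<open>\<phi>\<close> eliminated by means of those for 0 and 1. All
  terms cancel except those with \<open>w\<^sup>2 * a1\<^sup>2\<close>, so that \<open>\<phi> 0 \<noteq> 0\<close> and \<open>deriv \<phi> 0 \<noteq> 0\<close> leave an
  equation for the generating function alone.\<close>

lemma quadratic_ODE_at:
  assumes w: "w \<in> unit_disk" "w \<noteq> 0"
  shows "k (cnj a0 * w) * deriv (deriv k) (cnj a0 * w) = 2 * k2 / k1\<^sup>2 * (deriv k (cnj a0 * w))\<^sup>2"
proof -
  define K K' K'' where "K = k (cnj a0 * w)" and "K' = deriv k (cnj a0 * w)"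
    and "K'' = deriv (deriv k) (cnj a0 * w)"
  have cnj_a1: "cnj a1 = a1" and cnj_c: "cnj c = c"
    using a1_real c_real by (simp_all only: Reals_cnj_iff)
  have atoms: "cnj (k (cnj w * a0)) = K" "cnj (deriv k (cnj w * a0)) = K'"
    "cnj (deriv (deriv k) (cnj w * a0)) = K''"
    unfolding cnj_k[OF disk(1)[OF w(1)]] K_def K'_def K''_def
    by (simp_all only: complex_cnj_mult complex_cnj_cnj mult.commute)
  define T where "T = cnj (taylor_coeff \<phi> 2)"
  have T: "T = a1 * a0 * (2 * k2 / k1 - k1)"
    by (simp add: T_def phi2 cnj_a1)
  have "cnj (\<psi> w * \<phi> w ^ 2) * k2 = c * ((cnj w)\<^sup>2 * deriv (deriv k) (cnj w * a0) * a1\<^sup>2 / 2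
       + cnj w * deriv k (cnj w * a0) * taylor_coeff \<phi> 2)
       + c * cnj a0 * k1 * (cnj w * deriv k (cnj w * a0) * a1)
       + c * (cnj a0)\<^sup>2 * k2 * k (cnj w * a0)"
    using adjoint_identity[of 2 w] w coeffs_k_phi[OF w(1)] psi_coeffs[of 0] psi_coeffs[of 1] psi_coeffs[of 2]
    by (simp add: beta_0 numeral_2_eq_2 atMost_Suc mult_ac add_ac)
  then have "cnj (cnj (\<psi> w * \<phi> w ^ 2) * k2) = cnj (c * ((cnj w)\<^sup>2 * deriv (deriv k) (cnj w * a0) * a1\<^sup>2 / 2
       + cnj w * deriv k (cnj w * a0) * taylor_coeff \<phi> 2)
       + c * cnj a0 * k1 * (cnj w * deriv k (cnj w * a0) * a1)
       + c * (cnj a0)\<^sup>2 * k2 * k (cnj w * a0))"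
    by simp
  also have "\<dots> = c * (w\<^sup>2 * K'' * a1\<^sup>2 / 2 + w * K' * T) + c * a0 * k1 * (w * K' * a1) + c * a0\<^sup>2 * k2 * K"
    by (simp only: complex_cnj_mult complex_cnj_add complex_cnj_power complex_cnj_divide
        complex_cnj_numeral complex_cnj_complex_of_real complex_cnj_cnj cnj_a1 cnj_c atoms T_def)
  also have "cnj (cnj (\<psi> w * \<phi> w ^ 2) * k2) = c * K * (\<phi> w)\<^sup>2 * k2"
    by (simp only: complex_cnj_mult complex_cnj_cnj complex_cnj_complex_of_real psi_eq[OF w(1)] K_def)
  finally have "c * (K * (\<phi> w)\<^sup>2 * k2) = c * (w\<^sup>2 * K'' * a1\<^sup>2 / 2 + w * K' * T + a0 * k1 * (w * K' * a1)
       + a0\<^sup>2 * k2 * K)"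
    by (simp only: ring_distribs mult.assoc add.assoc)
  then have A: "K * (\<phi> w)\<^sup>2 * k2 = w\<^sup>2 * K'' * a1\<^sup>2 / 2 + w * K' * T + a0 * k1 * (w * K' * a1)
       + a0\<^sup>2 * k2 * K"
    by (rule iffD1[OF mult_left_cancel[OF c_nonzero]])
  have B: "K * \<phi> w = a0 * K + a1 / k1 * (w * K')"
    using phi_eq[OF w(1)] by (simp add: K_def K'_def)
  \<comment> \<open>Multiplication by \<open>K\<close> avoids a division, as \<open>K\<close> is not yet known to be nonzero.\<close>
  have "(K * \<phi> w)\<^sup>2 * k2 = K * (w\<^sup>2 * K'' * a1\<^sup>2 / 2 + w * K' * T + a0 * k1 * (w * K' * a1) + a0\<^sup>2 * k2 * K)"
    unfolding A[symmetric] by (simp add: power2_eq_square)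
  then have "(w * a1)\<^sup>2 * (K * K'') = (w * a1)\<^sup>2 * (2 * k2 / k1\<^sup>2 * K'\<^sup>2)"
    unfolding B T using k1_nonzero(1) by (rule quadratic_ODE_algebra)
  moreover have "(w * a1)\<^sup>2 \<noteq> 0" using w \<phi>'0 by simp
  ultimately show ?thesis
    unfolding K_def K'_def K''_def by (rule iffD1[OF mult_left_cancel, rotated])
qed

text \<open>The constant ratio of \<open>k * k''\<close> to \<open>(k')\<^sup>2\<close>, read off at 0.\<close>

definition "\<mu> = 2 * \<beta> 1 ^ 4 / (\<beta> 2)\<^sup>2"

text \<open>Chosen so that \<open>k' 0 * k / k'\<close> is \<open>1 - l * z\<close>.\<close>

definition "l = 1 / (\<beta> 1)\<^sup>2 * (\<mu> - 1)"

lemma mu_eq: "complex_of_real \<mu> = 2 * k2 / k1\<^sup>2"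
proof -
  have "\<mu> = 2 * (1 / (\<beta> 2)\<^sup>2) / (1 / (\<beta> 1)\<^sup>2)\<^sup>2"
    by (simp add: \<mu>_def power_divide flip: power_mult)
  also have "complex_of_real \<dots> = 2 * k2 / k1\<^sup>2" by simp
  finally show ?thesis .
qed

text \<open>The quadratic equation is available only on the ball of radius \<open>cmod a0\<close>, the range of
  \<open>w \<mapsto> cnj a0 * w\<close>; this is enough, because its first integral extends to the whole disk.\<close>

lemma linear_ODE:
  assumes z: "z \<in> unit_disk"
  shows "deriv k z * (1 - complex_of_real l * z) = complex_of_real (1 / (\<beta> 1)\<^sup>2) * k z"
proof -
  have "deriv k z * (1 - (complex_of_real \<mu> - 1) * deriv k 0 * z) = deriv k 0 * k z"
  proof (rule quadratic_ODE_linearize[OF k_hol(1) generating_fun_0 _ _ _ _ z])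
    show "deriv k 0 \<noteq> 0" unfolding deriv_generating_fun_0 by (rule k1_nonzero)
    show "0 < cmod a0" "cmod a0 \<le> 1" using \<phi>0 a0_disk by auto
    fix z :: complex assume z: "z \<in> ball 0 (cmod a0)"
    show "k z * deriv (deriv k) z = complex_of_real \<mu> * (deriv k z)\<^sup>2"
    \<comment> \<open>The point \<open>z\<close> is of the form \<open>cnj a0 * w\<close>, and only \<open>w \<noteq> 0\<close> was treated before.\<close>
    proof (cases "z = 0")
      case True
      have "deriv (deriv k) 0 = 2 * k2"
        using taylor_coeff_simps(3)[OF k_hol(1)] unfolding taylor_coeff_generating_fun by simp
      then show ?thesis
        unfolding True deriv_generating_fun_0 generating_fun_0 mu_eq using k1_nonzero(1) by simp
    next
      case False
      define w where "w = z / cnj a0"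
      have w: "w \<in> unit_disk" "w \<noteq> 0" "cnj a0 * w = z"
        using z False \<phi>0 by (auto simp: w_def norm_divide)
      show ?thesis
        using quadratic_ODE_at[OF w(1,2)] unfolding w(3) mu_eq .
    qed
  qed
  moreover have "complex_of_real l = (complex_of_real \<mu> - 1) * k1"
    by (simp add: l_def)
  ultimately show ?thesis
    unfolding deriv_generating_fun_0 by simp
qed

lemmas l_bounds = linear_ODE_parameter_bounds[OF linear_ODE]

lemma k_eq: "z \<in> unit_disk \<Longrightarrow> k z = binomial_kernel (1 / (\<beta> 1)\<^sup>2) l z"
  by (rule linear_ODE_solution[OF k_hol(1) generating_fun_0 l_bounds linear_ODE])

lemma phi_form:
  assumes w: "w \<in> unit_disk"
  shows "\<phi> w = a0 + a1 * complex_of_real ((\<beta> 1)\<^sup>2) * w * (deriv k (cnj a0 * w) / k (cnj a0 * w))"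
proof -
  have "k (cnj a0 * w) \<noteq> 0"
    using k_eq[OF disk(2)[OF w]] binomial_kernel_nonzero[OF l_bounds disk(2)[OF w]] by simp
  then show ?thesis using phi_eq[OF w] by (simp add: field_simps)
qed

end

section \<open>The characterization\<close>

theorem theorem1p2:
  fixes \<beta> :: "nat \<Rightarrow> real" and \<phi> \<psi> :: "complex \<Rightarrow> complex"
  assumes "weight_seq \<beta>"
    and "\<phi> holomorphic_on unit_disk" and "\<phi> ` unit_disk \<subseteq> unit_disk"
    and "\<phi> 0 \<noteq> 0" and "deriv \<phi> 0 \<noteq> 0"
    and "\<psi> holomorphic_on unit_disk" and "\<exists>z\<in>unit_disk. \<psi> z \<noteq> 0"
  defines "k \<equiv> generating_fun \<beta>"
    and "W \<equiv> weighted_comp \<psi> \<phi>"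
    and "lam \<equiv> 1 / (\<beta> 1)\<^sup>2 * (2 * \<beta> 1 ^ 4 / (\<beta> 2)\<^sup>2 - 1)"
    and "a0 \<equiv> \<phi> 0" and "a1 \<equiv> deriv \<phi> 0" and "c \<equiv> \<psi> 0"
  defines "cond_i \<equiv> wh_bounded \<beta> W \<and> wh_hermitian \<beta> W"
    and "cond_ii \<equiv> wh_bounded \<beta> W \<and>
      wh_adjoint \<beta> W (on_disk (\<lambda>z. 1)) = W (on_disk (\<lambda>z. 1)) \<and>
      wh_adjoint \<beta> W (on_disk (\<lambda>z. z)) = W (on_disk (\<lambda>z. z)) \<and>
      wh_adjoint \<beta> W (on_disk (\<lambda>z. z\<^sup>2)) = W (on_disk (\<lambda>z. z\<^sup>2))"
    and "cond_iii \<equiv>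
      (if 2 * \<beta> 1 ^ 4 / (\<beta> 2)\<^sup>2 = 1
       then \<forall>z\<in>unit_disk. k z = exp (z / complex_of_real ((\<beta> 1)\<^sup>2))
       else 0 < lam \<and> lam \<le> 1 \<and>
         (\<forall>z\<in>unit_disk. k z =
            (1 - complex_of_real lam * z) powr complex_of_real (- (1 / (lam * (\<beta> 1)\<^sup>2))))) \<and>
      a1 \<in> \<real> \<and> c \<in> \<real> \<and>
      (\<forall>z\<in>unit_disk. \<psi> z = c * k (cnj a0 * z)) \<and>
      (\<forall>z\<in>unit_disk. \<phi> z =
         a0 + a1 * complex_of_real ((\<beta> 1)\<^sup>2) * z * (deriv k (cnj a0 * z) / k (cnj a0 * z)))"
  shows "(cond_i \<longleftrightarrow> cond_ii) \<and> (cond_ii \<longleftrightarrow> cond_iii)"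
proof -
  interpret weighted_hardy_space \<beta> by unfold_locales fact
  have mono: "mono_fun 0 = on_disk (\<lambda>z. 1)" "mono_fun 1 = on_disk (\<lambda>z. z)"
    by simp_all
  have lam_0: "lam = 0 \<longleftrightarrow> 2 * \<beta> 1 ^ 4 / (\<beta> 2)\<^sup>2 = 1"
    unfolding lam_def mult_eq_0_iff by simp
  have kernel_form: "(if 2 * \<beta> 1 ^ 4 / (\<beta> 2)\<^sup>2 = 1
       then \<forall>z\<in>unit_disk. k z = exp (z / complex_of_real ((\<beta> 1)\<^sup>2))
       else 0 < lam \<and> lam \<le> 1 \<and>
         (\<forall>z\<in>unit_disk. k z =
            (1 - complex_of_real lam * z) powr complex_of_real (- (1 / (lam * (\<beta> 1)\<^sup>2)))))
     \<longleftrightarrow> 0 \<le> lam \<and> lam \<le> 1 \<and> (\<forall>z\<in>unit_disk. k z = binomial_kernel (1 / (\<beta> 1)\<^sup>2) lam z)"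
  proof (cases "lam = 0")
    case True
    then show ?thesis using lam_0 by (simp add: binomial_kernel_def)
  next
    case False
    then have "2 * \<beta> 1 ^ 4 / (\<beta> 2)\<^sup>2 \<noteq> 1" using lam_0 by simp
    moreover have "1 / (\<beta> 1)\<^sup>2 / lam = 1 / (lam * (\<beta> 1)\<^sup>2)" by simp
    then have "binomial_kernel (1 / (\<beta> 1)\<^sup>2) lam z
        = (1 - complex_of_real lam * z) powr complex_of_real (- (1 / (lam * (\<beta> 1)\<^sup>2)))" for z
      unfolding binomial_kernel_def using False by (simp only: if_False)
    ultimately show ?thesis using False by auto
  qed
  have i_ii: "cond_ii" if i: "cond_i"
  proof -
    have "wh_bounded \<beta> W" and fixed: "\<And>f. f \<in> weighted_hardy \<beta> \<Longrightarrow> wh_adjoint \<beta> W f = W f"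
      using i by (simp_all add: cond_i_def wh_hermitian_def)
    then show ?thesis
      unfolding cond_ii_def mono[symmetric] by (intro conjI fixed mono_fun_in_hardy)
  qed
  have ii_iii: "cond_iii" if ii: "cond_ii"
  proof -
    interpret hermitian_on_quadratics \<beta> \<psi> \<phi>
    proof unfold_locales
      show "wh_bounded \<beta> (weighted_comp \<psi> \<phi>)" using ii by (simp add: cond_ii_def W_def)
      fix n :: nat assume "n \<le> 2"
      then consider "n = 0" | "n = 1" | "n = 2" by linarith
      then show "wh_adjoint \<beta> (weighted_comp \<psi> \<phi>) (mono_fun n) = weighted_comp \<psi> \<phi> (mono_fun n)"
        using ii unfolding cond_ii_def W_def mono[symmetric] by cases blast+
    qed (fact assms)+
    have lam: "lam = l" by (simp add: lam_def l_def \<mu>_def)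
    show ?thesis
      unfolding cond_iii_def kernel_form unfolding lam k_def a0_def a1_def c_def
      by (intro conjI ballI l_bounds k_eq a1_real c_real psi_eq phi_form)
  qed
  have iii_i: "cond_i" if iii: "cond_iii"
  proof -
    have lam: "0 \<le> lam" "lam \<le> 1"
      and k: "\<And>z. z \<in> unit_disk \<Longrightarrow> k z = binomial_kernel (1 / (\<beta> 1)\<^sup>2) lam z"
      and real: "a1 \<in> \<real>" "c \<in> \<real>"
      and forms: "\<And>z. z \<in> unit_disk \<Longrightarrow> \<psi> z = c * k (cnj a0 * z)"
        "\<And>z. z \<in> unit_disk \<Longrightarrow> \<phi> z =
           a0 + a1 * complex_of_real ((\<beta> 1)\<^sup>2) * z * (deriv k (cnj a0 * z) / k (cnj a0 * z))"
      using iii unfolding cond_iii_def kernel_form by blast+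
    show ?thesis
      unfolding cond_i_def W_def
      by (intro conjI bounded_hermitian_of_binomial_kernel[OF assms(6,2,3) lam
            k[unfolded k_def] real forms[unfolded k_def a0_def]])
  qed
  show ?thesis using i_ii ii_iii iii_i by blast
qed

end
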